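(* Let $\mathbb{K}\in\{\mathbb{R},\mathbb{C},\mathbb{H}\}$, let $n\geq 1$, and let $G=O(n,\mathbb{K})=\{A\in \mathcal{M}_{n\times n}(\mathbb{K})\colon AA^*=I\}$. Let $X\in\mathcal{M}_{n\times n}(\mathbb{K})$ with $|X|=1$, let $0<t_1<\dots<t_k$ be the distinct positive singular values of $X$, with multiplicities $n_1,\dots,n_k\geq 1$, and let $n_0\geq 0$ be the multiplicity of $0$ as a singular value of $X$ (so $n_0+n_1+\dots+n_k=n$). For integers $0\leq i_q\leq n_q$ ($1\leq q\leq k$), let $\Sigma[n_0,i_1,\dots,i_k]\subset G$ be the corresponding component of the critical set of the height function $h_X\colon G\to\mathbb{R}$, $h_X(A)=\Re\mathrm{Tr}(X^*A)$, as described in the context. Then $$\mathrm{cat}\, G+1\leq \sum_{\substack{(i_1,\dots,i_k)\\ 0\leq i_q\leq n_q}}\left(\mathrm{cat}_G\,\Sigma[n_0,i_1,\dots,i_k]+1\right).$$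
   Context: Here $\mathbb{H}$ denotes the quaternions, $A^*$ is the conjugate transpose, $\Re\mathrm{Tr}$ is the real part of the trace, and $\mathcal{M}_{n\times n}(\mathbb{K})$ carries the Euclidean product $\langle A,B\rangle=\Re\mathrm{Tr}(A^*B)$ with norm $|\cdot|$. Thus $G$ is the orthogonal, unitary or symplectic group according to $\mathbb{K}=\mathbb{R},\mathbb{C},\mathbb{H}$. Write $O(m)=O(m,\mathbb{K})$. LS category: an open subset of $G$ is categorical if it is contractible in $G$, i.e. its inclusion into $G$ is homotopic to a constant map. $\mathrm{cat}\, G$ is the least integer $k\geq 0$ such that $G$ can be covered by $k+1$ categorical open subsets. For $A\subset G$, the relative category $\mathrm{cat}_G A$ is the least integer $k\geq 0$ such that $A$ can be covered by $k+1$ categorical open subsets of $G$. The submanifolds $\Sigma[n_0,i_1,\dots,i_k]$: let $X=UDV^*$ be a singular value decomposition, with $U,V\in G$ and $D=\mathrm{diag}(0,\dots,0,t_1,\dots,t_1,\dots,t_k,\dots,t_k)$, where $0$ is repeated $n_0$ times and $t_q$ is repeated $n_q$ times. The diffeomorphism $A\mapsto U^*AV$ of $G$ carries the critical set of $h_X$ onto the critical set of $h_D$. The latter is the disjoint union, over all $(i_1,\dots,i_k)$ with $0\leq i_q\leq n_q$, of the sets of block-diagonal matrices $\mathrm{diag}(A_0,A_1,\dots,A_k)$ with $A_q\in O(n_q)$ for $0\leq q\leq k$ (the block $A_0$ being absent when $n_0=0$) and such that, for each $q\geq 1$, $A_q^2=I$ and $A_q$ is conjugate in $O(n_q)$ to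 $\mathrm{diag}(-I_{i_q},+I_{n_q-i_q})$. $\Sigma[n_0,i_1,\dots,i_k]\subset G$ denotes the subset of the critical set of $h_X$ corresponding to $(i_1,\dots,i_k)$ under this diffeomorphism. As a manifold it is diffeomorphic to $$O(n_0)\times G_{i_1}^{n_1}\times\cdots\times G_{i_k}^{n_k},\qquad G_q^p=\frac{O(p)}{O(q)\times O(p-q)}.$$ Since relative category is invariant under diffeomorphisms of $G$, $\mathrm{cat}_G\,\Sigma[n_0,i_1,\dots,i_k]$ does not depend on the choice of $U,V$. *)

theory Defs
  imports "HOL-Analysis.Analysis"
begin

text \<open>
  By the Frobenius theorem the types of this class are, up to isomorphism, exactly the reals,
  the complex numbers and the quaternions; the last axiom forces \<open>star\<close> to be the usual
  conjugation. All three are proved to be instances below.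
\<close>

class rch_algebra = real_normed_div_algebra + euclidean_space +
  fixes star :: "'a \<Rightarrow> 'a"
  assumes star_add: "star (x + y) = star x + star y"
    and star_mult: "star (x * y) = star y * star x"
    and star_star: "star (star x) = x"
    and star_mult_self: "star x * x = (norm x)\<^sup>2 *\<^sub>R 1"

instantiation real :: rch_algebra
begin

definition star_real :: "real \<Rightarrow> real" where "star_real x = x"

instance by standard (simp_all add: star_real_def power2_eq_square)

end

instantiation complex :: rch_algebra
begin

definition star_complex :: "complex \<Rightarrow> complex" where "star_complex = cnj"

instance
proof
  show "star z * z = (norm z)\<^sup>2 *\<^sub>R 1" for z :: complex
    by (simp only: star_complex_def mult.commute[of "cnj z"] complex_norm_square[symmetric])
      (simp add: scaleR_conv_of_real)
qed (simp_all add: star_complex_def)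

end

datatype quat = Quat (qre: real) (qi: real) (qj: real) (qk: real)

lemma quat_eq_iff: "x = y \<longleftrightarrow> qre x = qre y \<and> qi x = qi y \<and> qj x = qj y \<and> qk x = qk y"
  by (cases x; cases y) simp

instantiation quat :: real_vector
begin

definition zero_quat where "0 = Quat 0 0 0 0"
definition plus_quat where
  "x + y = Quat (qre x + qre y) (qi x + qi y) (qj x + qj y) (qk x + qk y)"
definition minus_quat where
  "x - y = Quat (qre x - qre y) (qi x - qi y) (qj x - qj y) (qk x - qk y)"
definition uminus_quat where "- x = Quat (- qre x) (- qi x) (- qj x) (- qk x)"
definition scaleR_quat where "r *\<^sub>R x = Quat (r * qre x) (r * qi x) (r * qj x) (r * qk x)"

instance
  by standard
    (simp_all add: quat_eq_iff zero_quat_def plus_quat_def minus_quat_def uminus_quat_def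
      scaleR_quat_def algebra_simps)

end

lemmas quat_linear_defs =
  zero_quat_def plus_quat_def minus_quat_def uminus_quat_def scaleR_quat_def

instantiation quat :: real_algebra_1
begin

definition one_quat where "1 = Quat 1 0 0 0"
definition times_quat where
  "x * y = Quat
    (qre x * qre y - qi x * qi y - qj x * qj y - qk x * qk y)
    (qre x * qi y + qi x * qre y + qj x * qk y - qk x * qj y)
    (qre x * qj y - qi x * qk y + qj x * qre y + qk x * qi y)
    (qre x * qk y + qi x * qj y - qj x * qi y + qk x * qre y)"

instance
  by standard
    (simp_all add: quat_eq_iff quat_linear_defs one_quat_def times_quat_def algebra_simps)

end

instantiation quat :: real_inner
begin

definition inner_quat where
  "inner x y = qre x * qre y + qi x * qi y + qj x * qj y + qk x * qk y"
definition norm_quat where "norm (x :: quat) = sqrt (inner x x)"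
definition sgn_quat where "sgn (x :: quat) = x /\<^sub>R norm x"
definition dist_quat where "dist (x :: quat) y = norm (x - y)"
definition uniformity_quat where
  "(uniformity :: (quat \<times> quat) filter) = (INF e\<in>{0 <..}. principal {(x, y). dist x y < e})"
definition open_quat where
  "open (U :: quat set) \<longleftrightarrow> (\<forall>x\<in>U. \<forall>\<^sub>F (x', y) in uniformity. x' = x \<longrightarrow> y \<in> U)"

instance
proof
  fix x y z :: quat and r :: real
  show "inner x x = 0 \<longleftrightarrow> x = 0"
    by (auto simp: inner_quat_def quat_eq_iff zero_quat_def
        add_nonneg_eq_0_iff add_nonneg_nonneg)
  show "inner x y = inner y x" "0 \<le> inner x x"
    "inner (x + y) z = inner x z + inner y z" "inner (r *\<^sub>R x) y = r * inner x y"
    by (simp_all add: inner_quat_def plus_quat_def scaleR_quat_def algebra_simps)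
qed (fact dist_quat_def sgn_quat_def uniformity_quat_def open_quat_def norm_quat_def)+

end

instantiation quat :: real_normed_div_algebra
begin

definition inverse_quat where
  "inverse x = Quat (qre x) (- qi x) (- qj x) (- qk x) /\<^sub>R inner x x"
definition divide_quat where "(x :: quat) div y = x * inverse y"

instance
proof
  fix x y :: quat
  have self_mult: "Quat (qre x) (- qi x) (- qj x) (- qk x) * x = inner x x *\<^sub>R 1"
    "x * Quat (qre x) (- qi x) (- qj x) (- qk x) = inner x x *\<^sub>R 1"
    by (simp_all add: one_quat_def times_quat_def scaleR_quat_def inner_quat_def)
  show "inverse x * x = 1" "x * inverse x = 1" if "x \<noteq> 0"
    using that by (simp_all add: inverse_quat_def self_mult)
  show "x div y = x * inverse y" by (simp add: divide_quat_def)
  show "inverse (0 :: quat) = 0"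
    by (simp add: inverse_quat_def quat_linear_defs)
  have "inner (x * y) (x * y) = inner x x * inner y y"
    unfolding inner_quat_def times_quat_def quat.sel by algebra
  then show "norm (x * y) = norm x * norm y"
    by (simp add: norm_quat_def real_sqrt_mult)
qed

end

instantiation quat :: euclidean_space
begin

definition Basis_quat where "Basis = {Quat 1 0 0 0, Quat 0 1 0 0, Quat 0 0 1 0, Quat 0 0 0 1}"

instance
  by standard (auto simp: Basis_quat_def inner_quat_def zero_quat_def quat.expand)

end

instantiation quat :: rch_algebra
begin

definition star_quat where "star x = Quat (qre x) (- qi x) (- qj x) (- qk x)"

instance
proof
  fix x y :: quat
  show "star x * x = (norm x)\<^sup>2 *\<^sub>R 1"
    by (simp add: star_quat_def times_quat_def power2_norm_eq_inner inner_quat_def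
        scaleR_quat_def one_quat_def)
qed (simp_all add: quat_eq_iff star_quat_def plus_quat_def times_quat_def algebra_simps)

end

type_synonym ('a, 'n) square_matrix = "(('a, 'n) vec, 'n) vec"

definition adjoint_matrix :: "'a::rch_algebra^'n^'m \<Rightarrow> 'a^'m^'n" where
  "adjoint_matrix A = (\<chi> i j. star (A $ j $ i))"

text \<open>The real part of a scalar \<open>z\<close> is \<open>inner 1 z\<close>.\<close>

definition Re_trace :: "'a::rch_algebra^'n^'n \<Rightarrow> real" where
  "Re_trace A = inner 1 (trace A)"

definition unitary_group :: "('a::rch_algebra^'n^'n) set" where
  "unitary_group = {A. A ** adjoint_matrix A = mat 1}"

definition height ::
    "('a::rch_algebra, 'n::finite) square_matrix \<Rightarrow> ('a, 'n) square_matrix \<Rightarrow> real" where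
  "height X A = Re_trace (adjoint_matrix X ** A)"

lemma inner_eq_inner_1_star: "inner x y = inner 1 (star x * y)" for x y :: "'a::rch_algebra"
proof -
  have pol: "star u * v + star v * u = (2 * inner u v) *\<^sub>R 1" for u v :: 'a
  proof -
    have "star u * u + star v * v + (star u * v + star v * u) = star (u + v) * (u + v)"
      by (simp add: star_add algebra_simps)
    then have "((norm u)\<^sup>2 + (norm v)\<^sup>2) *\<^sub>R 1 + (star u * v + star v * u)
        = ((norm (u + v))\<^sup>2 *\<^sub>R 1 :: 'a)"
      by (simp add: star_mult_self scaleR_add_left)
    moreover have "(norm (u + v))\<^sup>2 = (norm u)\<^sup>2 + (norm v)\<^sup>2 + 2 * inner u v"
      by (simp add: power2_norm_eq_inner inner_add inner_commute algebra_simps)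
    ultimately show ?thesis by (simp add: algebra_simps)
  qed
  have star_1: "star (1 :: 'a) = 1"
    using star_mult_self[of "1 :: 'a"] by simp
  have inner_1: "inner (1 :: 'a) 1 = 1"
    by (simp add: norm_eq_1[symmetric])
  have re: "inner 1 (star z) = inner 1 z" for z :: 'a
  proof -
    have "inner 1 (z + star z) = inner (1 :: 'a) ((2 * inner 1 z) *\<^sub>R 1)"
      using pol[of 1 z] by (simp add: star_1)
    then show ?thesis by (simp add: inner_add inner_1)
  qed
  have "2 * inner 1 (star x * y) = inner 1 (star x * y + star y * x)"
    using re[of "star x * y"] by (simp add: inner_add star_mult star_star)
  also have "\<dots> = 2 * inner x y"
    by (simp add: pol inner_1)
  finally show ?thesis by simp
qed

text \<open>
  The library inner product (and hence the library norm) on matrices is the one given by the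
  real part of the trace.
\<close>

lemma inner_matrix_eq_Re_trace:
  "inner A B = Re_trace (adjoint_matrix A ** B)" for A B :: "'a::rch_algebra^'n^'n"
proof -
  have "inner A B = (\<Sum>j\<in>UNIV. \<Sum>i\<in>UNIV. inner (A $ j $ i) (B $ j $ i))"
    by (simp add: inner_vec_def)
  also have "\<dots> = (\<Sum>i\<in>UNIV. \<Sum>j\<in>UNIV. inner (A $ j $ i) (B $ j $ i))"
    by (rule sum.swap)
  also have "\<dots> = (\<Sum>i\<in>UNIV. \<Sum>j\<in>UNIV. inner 1 (star (A $ j $ i) * B $ j $ i))"
    by (simp add: inner_eq_inner_1_star[symmetric])
  also have "\<dots> = Re_trace (adjoint_matrix A ** B)"
    by (simp add: Re_trace_def trace_def adjoint_matrix_def matrix_matrix_mult_def inner_sum_right)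
  finally show ?thesis .
qed

definition categorical :: "'a::topological_space set \<Rightarrow> 'a set \<Rightarrow> bool" where
  "categorical G W \<longleftrightarrow> openin (top_of_set G) W \<and>
     (\<exists>c\<in>G. homotopic_with_canon (\<lambda>_. True) W G (\<lambda>x. x) (\<lambda>_. c))"

text \<open>The value is \<open>\<infinity>\<close> if there is no finite cover (the infimum of the empty set).\<close>

definition rel_category :: "'a::topological_space set \<Rightarrow> 'a set \<Rightarrow> enat" where
  "rel_category G A = (INF k \<in> {k::nat. \<exists>W. (\<forall>j\<le>k. categorical G (W j)) \<and> A \<subseteq> (\<Union>j\<le>k. W j)}. enat k)"

definition LS_category :: "'a::topological_space set \<Rightarrow> enat" where
  "LS_category G = (INF k \<in> {k::nat. \<exists>W. (\<forall>j\<le>k. categorical G (W j)) \<and> G = (\<Union>j\<le>k. W j)}. enat k)"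

text \<open>
  For a submanifold \<open>S\<close> the tangent vectors at \<open>x\<close> are the velocities of curves in \<open>S\<close>
  through \<open>x\<close>, so the condition says that the differential of \<open>f\<close> vanishes on the tangent space.
\<close>

definition critical_set :: "'a::real_normed_vector set \<Rightarrow> ('a \<Rightarrow> real) \<Rightarrow> 'a set" where
  "critical_set S f = {x \<in> S. \<forall>\<gamma> v. (\<forall>s. \<gamma> s \<in> S) \<and> \<gamma> 0 = x \<and>
      (\<gamma> has_vector_derivative v) (at 0) \<longrightarrow>
      ((\<lambda>s. f (\<gamma> s)) has_real_derivative 0) (at 0)}"

text \<open>
  Given block sizes \<open>m 0, m 1, \<dots>\<close> the ordered index type is cut into consecutive blocks of
  these sizes; \<open>block_index m a\<close> is the number of the block containing \<open>a\<close>.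
\<close>

definition block_index :: "(nat \<Rightarrow> nat) \<Rightarrow> 'n::{finite,linorder} \<Rightarrow> nat" where
  "block_index m a = (LEAST q. card {b. b < a} < (\<Sum>p\<le>q. m p))"

definition diag_block :: "(nat \<Rightarrow> nat) \<Rightarrow> nat \<Rightarrow> 'n::{finite,linorder} set" where
  "diag_block m q = {a. block_index m a = q}"

text \<open>The matrix \<open>diag(t 0, \<dots>, t 0, t 1, \<dots>, t 1, \<dots>)\<close> with \<open>t q\<close> repeated \<open>m q\<close> times.\<close>

definition repeated_diag ::
    "(nat \<Rightarrow> nat) \<Rightarrow> (nat \<Rightarrow> real) \<Rightarrow> ('a::rch_algebra, 'n::{finite,linorder}) square_matrix" where
  "repeated_diag m t = (\<chi> a b. if a = b then of_real (t (block_index m a)) else 0)"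

text \<open>
  Square matrices with rows and columns indexed by a set \<open>S\<close> are represented by functions of
  which only the values on \<open>S \<times> S\<close> matter.
\<close>

definition mat_eq_on :: "'n set \<Rightarrow> ('n \<Rightarrow> 'n \<Rightarrow> 'a) \<Rightarrow> ('n \<Rightarrow> 'n \<Rightarrow> 'a) \<Rightarrow> bool" where
  "mat_eq_on S P Q \<longleftrightarrow> (\<forall>a\<in>S. \<forall>b\<in>S. P a b = Q a b)"

definition mat_mult_on ::
    "'n set \<Rightarrow> ('n \<Rightarrow> 'n \<Rightarrow> 'a::rch_algebra) \<Rightarrow> ('n \<Rightarrow> 'n \<Rightarrow> 'a) \<Rightarrow> 'n \<Rightarrow> 'n \<Rightarrow> 'a" where
  "mat_mult_on S P Q = (\<lambda>a b. \<Sum>c\<in>S. P a c * Q c b)"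

definition mat_star_on :: "('n \<Rightarrow> 'n \<Rightarrow> 'a::rch_algebra) \<Rightarrow> 'n \<Rightarrow> 'n \<Rightarrow> 'a" where
  "mat_star_on P = (\<lambda>a b. star (P b a))"

definition mat_one_on :: "'n \<Rightarrow> 'n \<Rightarrow> 'a::rch_algebra" where
  "mat_one_on = (\<lambda>a b. if a = b then 1 else 0)"

definition unitary_on :: "'n set \<Rightarrow> ('n \<Rightarrow> 'n \<Rightarrow> 'a::rch_algebra) set" where
  "unitary_on S = {P. mat_eq_on S (mat_mult_on S P (mat_star_on P)) mat_one_on}"

text \<open>The matrix \<open>diag(-I, I)\<close> on the ordered index set \<open>S\<close>, where \<open>-I\<close> has size \<open>i\<close>.\<close>

definition signature_on :: "('n::linorder) set \<Rightarrow> nat \<Rightarrow> 'n \<Rightarrow> 'n \<Rightarrow> 'a::rch_algebra" where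
  "signature_on S i = (\<lambda>a b. if a = b then (if card {c\<in>S. c < a} < i then - 1 else 1) else 0)"

text \<open>For unitary \<open>P\<close> the inverse in the conjugation \<open>P E P\<^sup>-\<^sup>1\<close> is the conjugate transpose.\<close>

definition conjugate_on ::
    "'n set \<Rightarrow> ('n \<Rightarrow> 'n \<Rightarrow> 'a::rch_algebra) \<Rightarrow> ('n \<Rightarrow> 'n \<Rightarrow> 'a) \<Rightarrow> bool" where
  "conjugate_on S A E \<longleftrightarrow>
     (\<exists>P\<in>unitary_on S. mat_eq_on S A (mat_mult_on S (mat_mult_on S P E) (mat_star_on P)))"

text \<open>The component of the critical set for the diagonal matrix \<open>repeated_diag m t\<close>.\<close>

definition diag_component ::
    "nat \<Rightarrow> (nat \<Rightarrow> nat) \<Rightarrow> (nat \<Rightarrow> nat) \<Rightarrow> ('a::rch_algebra, 'n::{finite,linorder}) square_matrix set" where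
  "diag_component k m i = {A.
     (\<forall>a b. block_index m a \<noteq> block_index m b \<longrightarrow> A $ a $ b = 0) \<and>
     (\<forall>q\<le>k. (\<lambda>a b. A $ a $ b) \<in> unitary_on (diag_block m q)) \<and>
     (\<forall>q\<in>{1..k}.
        mat_eq_on (diag_block m q)
          (mat_mult_on (diag_block m q) (\<lambda>a b. A $ a $ b) (\<lambda>a b. A $ a $ b)) mat_one_on \<and>
        conjugate_on (diag_block m q) (\<lambda>a b. A $ a $ b) (signature_on (diag_block m q) (i q)))}"

text \<open>The set \<open>\<Sigma>[m 0, i 1, \<dots>, i k]\<close>, where \<open>U\<close> and \<open>V\<close> come from a singular value
  decomposition of \<open>X\<close>.\<close>

definition critical_component ::
    "('a::rch_algebra, 'n::{finite,linorder}) square_matrix \<Rightarrow>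
     ('a, 'n) square_matrix \<Rightarrow> ('a, 'n) square_matrix \<Rightarrow>
     nat \<Rightarrow> (nat \<Rightarrow> nat) \<Rightarrow> (nat \<Rightarrow> nat) \<Rightarrow> ('a, 'n) square_matrix set" where
  "critical_component X U V k m i =
     {A \<in> critical_set unitary_group (height X). adjoint_matrix U ** A ** V \<in> diag_component k m i}"

end

theory Submission
  imports Defs
begin

text \<open>
  The theorem is an instance of the Lusternik--Schnirelmann principle: if a map \<open>\<phi>\<close> of a compact
  space \<open>G\<close> is homotopic to the identity, never lowers a function \<open>f\<close> and strictly raises it outside
  finitely many sets on each of which \<open>f\<close> is constant, then \<open>G\<close> is covered by as many categorical sets as these
  exceptional sets together need. This is \<open>categorical_cover_of_ascent\<close>; passing downwards through
  the levels of \<open>f\<close>, each exceptional set contributes its own cover, and everything else is pushed by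
  \<open>\<phi>\<close> into the part already covered. If some relative category is infinite, there is nothing to show.

  Here \<open>f\<close> is the height function, and \<open>\<phi>\<close> replaces its gradient flow, so that no differential equation
  has to be solved. Let \<open>W = X A\<^sup>* - A X\<^sup>*\<close>, a skew matrix that generates the gradient at \<open>A\<close>. The
  Cayley transform \<open>(I - s W)\<^sup>-\<^sup>1 (I + s W) A\<close> is a unitary matrix that depends continuously on \<open>s\<close> and
  \<open>A\<close> and equals \<open>A\<close> for \<open>s = 0\<close>. For a small fixed \<open>s\<close> it lies strictly higher than \<open>A\<close> unless \<open>W = 0\<close>
  (\<open>ascent_step_exists\<close>).

  It remains to identify the exceptional points. If \<open>W = 0\<close>, then \<open>A\<close> is critical
  (\<open>critical_if_generator_zero\<close>). In the coordinates \<open>U\<^sup>* A V\<close> the equation \<open>W = 0\<close> says that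
  \<open>U\<^sup>* A V\<close> times the diagonal matrix of singular values is hermitian. This forces \<open>U\<^sup>* A V\<close> to be
  block diagonal, with hermitian involutions as the blocks of the positive singular values
  (\<open>diag_component_if_hermitian_product\<close>). Such an involution is conjugate to some
  \<open>diag(-I, I)\<close>; over the reals, the complex numbers and the quaternions alike this follows by
  splitting off fixed vectors with Householder reflections
  (\<open>hermitian_involution_conjugate_signature\<close>). On each component the height is constant,
  because the real part of the trace is invariant under conjugation.
\<close>

section \<open>Categorical covers and ascending maps\<close>

text \<open>
  Counting sets instead of the index \<open>k\<close> of a cover by \<open>k + 1\<close> sets makes the bound additive and
  allows the empty cover.
\<close>

definition categorical_cover :: "'a::topological_space set \<Rightarrow> nat \<Rightarrow> 'a set \<Rightarrow> bool" where
  "categorical_cover G n A \<longleftrightarrow>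
     (\<exists>F. finite F \<and> card F \<le> n \<and> (\<forall>W\<in>F. categorical G W) \<and> A \<subseteq> \<Union>F)"

lemma categorical_cover_mono:
  "categorical_cover G n A \<Longrightarrow> n \<le> n' \<Longrightarrow> A' \<subseteq> A \<Longrightarrow> categorical_cover G n' A'"
  unfolding categorical_cover_def by (meson order_trans)

lemma categorical_cover_empty: "categorical_cover G n {}"
  unfolding categorical_cover_def by (rule exI[of _ "{}"]) simp

lemma categorical_cover_Un:
  assumes "categorical_cover G m A" and "categorical_cover G n B"
  shows "categorical_cover G (m + n) (A \<union> B)"
proof -
  from assms obtain F H where F: "finite F" "card F \<le> m" "\<forall>W\<in>F. categorical G W" "A \<subseteq> \<Union>F"
    and H: "finite H" "card H \<le> n" "\<forall>W\<in>H. categorical G W" "B \<subseteq> \<Union>H"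
    unfolding categorical_cover_def by metis
  have "card (F \<union> H) \<le> m + n"
    using card_Un_le[of F H] F(2) H(2) by linarith
  then show ?thesis
    unfolding categorical_cover_def using F H by (intro exI[of _ "F \<union> H"]) auto
qed

lemma categorical_cover_UN:
  assumes "finite J" and "\<And>j. j \<in> J \<Longrightarrow> categorical_cover G (n j) (K j)"
  shows "categorical_cover G (\<Sum>j\<in>J. n j) (\<Union>j\<in>J. K j)"
  using assms
  by (induction J rule: finite_induct) (simp_all add: categorical_cover_empty categorical_cover_Un)

lemma categorical_cover_rel_category:
  assumes "rel_category G A = enat k"
  shows "categorical_cover G (Suc k) A"
proof -
  let ?S = "{k::nat. \<exists>W. (\<forall>j\<le>k. categorical G (W j)) \<and> A \<subseteq> (\<Union>j\<le>k. W j)}"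
  have "?S \<noteq> {}"
  proof
    assume "?S = {}"
    then have "rel_category G A = \<infinity>"
      unfolding rel_category_def by (simp only: image_empty Inf_enat_def) simp
    with assms show False by simp
  qed
  then have "Inf (enat ` ?S) \<in> enat ` ?S"
    by (meson wellorder_InfI ex_in_conv image_is_empty)
  then have "k \<in> ?S"
    using assms unfolding rel_category_def by auto
  then obtain W where W: "\<forall>j\<le>k. categorical G (W j)" "A \<subseteq> (\<Union>j\<le>k. W j)"
    by auto
  have "card (W ` {..k}) \<le> Suc k"
    using card_image_le[of "{..k}" W] by simp
  then show ?thesis
    unfolding categorical_cover_def using W by (intro exI[of _ "W ` {..k}"]) auto
qed

text \<open>
  The cover of a nonempty \<open>G\<close> has at least one member, so its number of sets is a successor and
  the shift by one between the two ways of counting loses nothing.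
\<close>

lemma LS_category_le:
  assumes "categorical_cover G n G" and "G \<noteq> {}"
  shows "LS_category G + 1 \<le> enat n"
proof -
  obtain c where c: "c \<in> G" using assms(2) by auto
  obtain F where F: "finite F" "card F \<le> n" "\<forall>W\<in>F. categorical G W" "G \<subseteq> \<Union>F"
    using assms(1) unfolding categorical_cover_def by auto
  have "F \<noteq> {}" using F(4) c by auto
  then obtain k where k: "card F = Suc k"
    using F(1) by (metis card_gt_0_iff gr0_implies_Suc)
  obtain e where e: "bij_betw e {..<card F} F"
    using ex_bij_betw_nat_finite[OF F(1)] atLeast0LessThan by metis
  have "F = e ` {..k}"
    using e k by (simp add: bij_betw_def lessThan_Suc_atMost)
  moreover have "\<Union>F \<subseteq> G"
    using F(3) unfolding categorical_def by (auto dest: openin_imp_subset)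
  ultimately have "\<exists>W. (\<forall>j\<le>k. categorical G (W j)) \<and> G = (\<Union>j\<le>k. W j)"
    using F(3,4) by (intro exI[of _ e]) auto
  then have "LS_category G \<le> enat k"
    unfolding LS_category_def by (intro INF_lower) simp
  then have "LS_category G + 1 \<le> enat k + 1"
    by (rule add_right_mono)
  also have "enat k + 1 = enat (card F)"
    by (simp add: k one_enat_def)
  also have "\<dots> \<le> enat n" using F(2) by simp
  finally show ?thesis .
qed

text \<open>
  The inclusion of the preimage is homotopic to \<open>\<phi>\<close> restricted to it, which maps into \<open>W\<close>, and
  \<open>W\<close> can be contracted in \<open>G\<close>. Hence covers can be pulled back along \<open>\<phi>\<close>.
\<close>

lemma categorical_vimage:
  assumes W: "categorical G W" and hom: "homotopic_with_canon (\<lambda>_. True) G G (\<lambda>x. x) \<phi>"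
  shows "categorical G (G \<inter> \<phi> -` W)"
proof -
  have cont: "continuous_on G \<phi>" and im: "\<phi> ` G \<subseteq> G"
    using homotopic_with_imp_continuous[OF hom] homotopic_with_imp_subset2[OF hom] by auto
  from W obtain c where op: "openin (top_of_set G) W" and c: "c \<in> G"
    and hW: "homotopic_with_canon (\<lambda>_. True) W G (\<lambda>x. x) (\<lambda>_. c)"
    unfolding categorical_def by auto
  let ?V = "G \<inter> \<phi> -` W"
  have "openin (top_of_set G) ?V"
    using continuous_openin_preimage[OF cont _ op] im by auto
  moreover have "homotopic_with_canon (\<lambda>_. True) ?V G (\<lambda>x. x) (\<lambda>_. c)"
  proof -
    have 1: "homotopic_with_canon (\<lambda>_. True) ?V G (\<lambda>x. x) \<phi>"
      by (rule homotopic_with_subset_left[OF hom]) auto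
    have "continuous_on ?V \<phi>"
      using cont by (rule continuous_on_subset) auto
    then have "homotopic_with_canon (\<lambda>_. True) ?V G ((\<lambda>x. x) \<circ> \<phi>) ((\<lambda>_. c) \<circ> \<phi>)"
      by (intro homotopic_with_compose_continuous_right[OF hW]) auto
    then have "homotopic_with_canon (\<lambda>_. True) ?V G \<phi> (\<lambda>_. c)"
      by (simp add: o_def)
    with 1 show ?thesis by (rule homotopic_with_trans)
  qed
  ultimately show ?thesis
    unfolding categorical_def using c by auto
qed

lemma finite_isolated_level:
  fixes c :: "'j \<Rightarrow> real"
  assumes "finite J"
  shows "\<exists>\<eta>>0. \<forall>j\<in>J. \<bar>c j - l\<bar> \<le> \<eta> \<longrightarrow> c j = l"
proof -
  define S where "S = insert 1 ((\<lambda>j. \<bar>c j - l\<bar>) ` J - {0})"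
  have fin: "finite S" using assms by (simp add: S_def)
  have pos: "Min S > 0" using fin by (subst Min_gr_iff) (auto simp: S_def)
  have "c j = l" if "j \<in> J" "\<bar>c j - l\<bar> \<le> Min S / 2" for j
  proof (rule ccontr)
    assume "c j \<noteq> l"
    then have "Min S \<le> \<bar>c j - l\<bar>" using that(1) by (intro Min_le fin) (auto simp: S_def)
    then show False using that(2) pos by linarith
  qed
  then show ?thesis using half_gt_zero[OF pos] by blast
qed

text \<open>
  The Lusternik--Schnirelmann argument for a map \<open>\<phi>\<close> that is homotopic to the identity, never
  lowers \<open>f\<close> and raises it outside finitely many pieces \<open>K j\<close>, each lying on one level of \<open>f\<close>. The superlevel set
  of \<open>a\<close> needs only the categorical sets that cover the pieces at height at least \<open>a\<close>: for large
  \<open>a\<close> it is empty, and the claim persists as \<open>a\<close> decreases. Indeed, near a level \<open>l\<close> let \<open>F\<close> cover the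
  pieces on that level. By compactness \<open>\<phi>\<close> gains at least some \<open>\<delta> > 0\<close> on the part of a thin slab
  around \<open>l\<close> left over by \<open>F\<close>, so that \<open>\<phi>\<close> carries this part across the level \<open>l\<close>, where the cover
  already found can be pulled back.
\<close>

lemma categorical_cover_of_ascent:
  fixes G :: "'a::topological_space set" and f :: "'a \<Rightarrow> real" and c :: "'j \<Rightarrow> real"
  assumes G: "compact G" and f: "continuous_on G f"
    and hom: "homotopic_with_canon (\<lambda>_. True) G G (\<lambda>x. x) \<phi>"
    and mono: "\<And>x. x \<in> G \<Longrightarrow> f x \<le> f (\<phi> x)"
    and strict: "\<And>x. x \<in> G \<Longrightarrow> f (\<phi> x) = f x \<Longrightarrow> \<exists>j\<in>J. x \<in> K j"
    and J: "finite J"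
    and const: "\<And>j x. j \<in> J \<Longrightarrow> x \<in> K j \<Longrightarrow> f x = c j"
    and cover: "\<And>j. j \<in> J \<Longrightarrow> categorical_cover G (n j) (K j)"
  shows "categorical_cover G (\<Sum>j\<in>J. n j) G"
proof (cases "G = {}")
  case True
  then show ?thesis by (simp add: categorical_cover_empty)
next
  case False
  have \<phi>: "continuous_on G \<phi>" and im: "\<phi> ` G \<subseteq> G"
    using homotopic_with_imp_continuous[OF hom] homotopic_with_imp_subset2[OF hom] by auto
  define N where "N a = (\<Sum>j\<in>{j\<in>J. a \<le> c j}. n j)" for a
  define P where "P a \<longleftrightarrow> categorical_cover G (N a) {x\<in>G. a \<le> f x}" for a
  \<comment> \<open>A cover valid above a level extends to that level and slightly below it.\<close>
  have step: "\<exists>e>0. \<forall>a. l - e \<le> a \<and> a \<le> l \<longrightarrow> P a" if above: "\<And>b. b > l \<Longrightarrow> P b" for l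
  proof -
    obtain \<eta> where \<eta>: "\<eta> > 0" "\<forall>j\<in>J. \<bar>c j - l\<bar> \<le> \<eta> \<longrightarrow> c j = l"
      using finite_isolated_level[OF J] by metis
    let ?L = "{j\<in>J. c j = l}"
    have "categorical_cover G (\<Sum>j\<in>?L. n j) (\<Union>j\<in>?L. K j)"
      using J cover by (intro categorical_cover_UN) auto
    then obtain F where F: "finite F" "card F \<le> (\<Sum>j\<in>?L. n j)" "\<forall>W\<in>F. categorical G W"
      "(\<Union>j\<in>?L. K j) \<subseteq> \<Union>F"
      unfolding categorical_cover_def by blast
    let ?C = "{x\<in>G. l - \<eta> \<le> f x \<and> f x \<le> l + \<eta>} - \<Union>F"
    have opF: "openin (top_of_set G) (\<Union>F)"
      using F(3) unfolding categorical_def by auto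
    have "closedin (top_of_set G) (G \<inter> f -` {l - \<eta>..l + \<eta>})"
      using f by (rule continuous_closedin_preimage) simp
    then have "closedin (top_of_set G) (G \<inter> f -` {l - \<eta>..l + \<eta>} - \<Union>F)"
      using opF by (rule closedin_diff)
    moreover have "G \<inter> f -` {l - \<eta>..l + \<eta>} - \<Union>F = ?C"
      by auto
    ultimately have C: "compact ?C"
      using closedin_compact[OF G] by simp
    have gain: "f x < f (\<phi> x)" if "x \<in> ?C" for x
    proof -
      have False if eq: "f (\<phi> x) = f x"
      proof -
        obtain j where j: "j \<in> J" "x \<in> K j" using strict eq \<open>x \<in> ?C\<close> by blast
        then have "c j = l" using \<eta>(2) const[OF j] \<open>x \<in> ?C\<close> by (auto simp: abs_le_iff)
        then show False using j F(4) \<open>x \<in> ?C\<close> by auto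
      qed
      then show ?thesis using mono[of x] that by force
    qed
    obtain \<delta> where \<delta>: "\<delta> > 0" "\<And>x. x \<in> ?C \<Longrightarrow> f x + \<delta> \<le> f (\<phi> x)"
    proof (cases "?C = {}")
      case True
      then show ?thesis using that[of 1] by auto
    next
      case False
      have "continuous_on G (\<lambda>x. f (\<phi> x) - f x)"
        using f \<phi> im by (intro continuous_intros) (auto intro: continuous_on_compose2)
      then have "continuous_on ?C (\<lambda>x. f (\<phi> x) - f x)"
        by (rule continuous_on_subset) auto
      from continuous_attains_inf[OF C False this]
      obtain x0 where x0: "x0 \<in> ?C" "\<forall>x\<in>?C. f (\<phi> x0) - f x0 \<le> f (\<phi> x) - f x"
        by (rule bexE)
      show ?thesis
      proof (rule that)
        show "f (\<phi> x0) - f x0 > 0" using gain[OF x0(1)] by simp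
        show "f x + (f (\<phi> x0) - f x0) \<le> f (\<phi> x)" if "x \<in> ?C" for x
          using bspec[OF x0(2) that] by simp
      qed
    qed
    \<comment> \<open>A gain of at least \<open>2 * e\<close> lifts a point from above \<open>l - e\<close> to above \<open>l + e\<close>.\<close>
    define e where "e = min \<eta> (\<delta> / 2)"
    have e: "e > 0" "e \<le> \<eta>" "2 * e \<le> \<delta>" using \<eta> \<delta> by (auto simp: e_def)
    obtain H where H: "finite H" "card H \<le> N (l + e)" "\<forall>W\<in>H. categorical G W"
      "{x\<in>G. l + e \<le> f x} \<subseteq> \<Union>H"
      using above[of "l + e"] e unfolding P_def categorical_cover_def by auto
    have "P a" if a: "l - e \<le> a" "a \<le> l" for a
      unfolding P_def categorical_cover_def
    proof (intro exI conjI)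
      let ?H = "F \<union> (\<lambda>W. G \<inter> \<phi> -` W) ` H"
      show "finite ?H" using F(1) H(1) by simp
      have "?L \<union> {j\<in>J. l + e \<le> c j} \<subseteq> {j\<in>J. a \<le> c j}" using a e by auto
      then have "(\<Sum>j\<in>?L \<union> {j\<in>J. l + e \<le> c j}. n j) \<le> N a"
        unfolding N_def using J by (intro sum_mono2) auto
      moreover have "(\<Sum>j\<in>?L \<union> {j\<in>J. l + e \<le> c j}. n j) = (\<Sum>j\<in>?L. n j) + N (l + e)"
        unfolding N_def using J e by (intro sum.union_disjoint) auto
      moreover have "card ?H \<le> card F + card H"
        using card_Un_le[of F "(\<lambda>W. G \<inter> \<phi> -` W) ` H"]
          card_image_le[OF H(1), of "\<lambda>W. G \<inter> \<phi> -` W"] by linarith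
      ultimately show "card ?H \<le> N a" using F(2) H(2) by linarith
      show "\<forall>W\<in>?H. categorical G W"
        using F(3) H(3) categorical_vimage[OF _ hom] by auto
      show "{x\<in>G. a \<le> f x} \<subseteq> \<Union>?H"
      proof
        fix x assume x: "x \<in> {x\<in>G. a \<le> f x}"
        show "x \<in> \<Union>?H"
        proof (cases "x \<in> \<Union>F")
          case True
          then show ?thesis by auto
        next
          case notF: False
          have "l + e \<le> f (\<phi> x)"
          proof (cases "l + e \<le> f x")
            case True
            then show ?thesis using mono[of x] x by auto
          next
            case False
            then have "x \<in> ?C" using x a e notF by auto
            then have "f x + \<delta> \<le> f (\<phi> x)" by (rule \<delta>(2))
            then show ?thesis using x a e by auto
          qed
          then have "\<phi> x \<in> \<Union>H" using H(4) im x by auto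
          then show ?thesis using x by auto
        qed
      qed
    qed
    then show ?thesis using e(1) by auto
  qed
  obtain xm xM where xm: "xm \<in> G" "\<And>x. x \<in> G \<Longrightarrow> f xm \<le> f x"
    and xM: "xM \<in> G" "\<And>x. x \<in> G \<Longrightarrow> f x \<le> f xM"
    using continuous_attains_inf[OF G False f] continuous_attains_sup[OF G False f] by metis
  have "P a" for a
  proof (rule ccontr)
    assume a: "\<not> P a"
    \<comment> \<open>The supremum of the levels at which the claim fails is itself a level from which it extends
      downwards.\<close>
    let ?B = "{b. \<not> P b}"
    have bdd: "b \<le> f xM" if "b \<in> ?B" for b
    proof (rule ccontr)
      assume "\<not> b \<le> f xM"
      then have "{x\<in>G. b \<le> f x} = {}" using xM(2) by force
      then have "P b" unfolding P_def by (simp only: categorical_cover_empty)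
      then show False using that by simp
    qed
    then have bdd': "bdd_above ?B" by (rule bdd_aboveI)
    have above: "P b" if "b > Sup ?B" for b
      using that cSup_upper[OF _ bdd'] by force
    then obtain e where e: "e > 0" "\<And>b. Sup ?B - e \<le> b \<and> b \<le> Sup ?B \<Longrightarrow> P b"
      using step by metis
    have "b \<le> Sup ?B - e" if "b \<in> ?B" for b
      using that e(2)[of b] above[of b] by force
    then have "Sup ?B \<le> Sup ?B - e" using a by (intro cSup_least) auto
    then show False using e(1) by simp
  qed
  then have "categorical_cover G (N (f xm)) {x\<in>G. f xm \<le> f x}" unfolding P_def by blast
  moreover have "N (f xm) \<le> (\<Sum>j\<in>J. n j)"
    unfolding N_def using J by (intro sum_mono2) auto
  ultimately show ?thesis
    using xm(2) by (elim categorical_cover_mono) auto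
qed

section \<open>Conjugation and matrices over the three algebras\<close>

lemma star_one: "star (1 :: 'a::rch_algebra) = 1"
  using star_mult_self[of "1 :: 'a"] by simp

text \<open>
  The axioms determine conjugation as the reflection that fixes the real line. All further linear
  properties of \<open>star\<close> are read off from this formula.
\<close>

lemma star_eq: "star x = (2 * inner 1 x) *\<^sub>R 1 - x" for x :: "'a::rch_algebra"
proof -
  have "star (x + 1) * (x + 1) = star x * x + star x + x + 1"
    by (simp add: star_add star_one algebra_simps)
  then have "(norm (x + 1))\<^sup>2 *\<^sub>R 1 = ((norm x)\<^sup>2 + 1) *\<^sub>R 1 + star x + x"
    by (simp add: star_mult_self scaleR_add_left)
  moreover have "(norm (x + 1))\<^sup>2 = (norm x)\<^sup>2 + 1 + 2 * inner 1 x"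
    by (simp add: power2_norm_eq_inner inner_add inner_commute algebra_simps)
      (simp add: power2_norm_eq_inner[symmetric])
  ultimately show ?thesis by (simp add: algebra_simps)
qed

lemma star_scaleR: "star (r *\<^sub>R x) = r *\<^sub>R star x" for x :: "'a::rch_algebra"
  by (simp add: star_eq algebra_simps)

lemma star_diff: "star (x - y) = star x - star y" for x :: "'a::rch_algebra"
  by (simp add: star_eq inner_diff_right algebra_simps)

lemma star_zero: "star (0 :: 'a::rch_algebra) = 0"
  by (simp add: star_eq)

lemma star_sum: "star (\<Sum>a\<in>S. f a) = (\<Sum>a\<in>S. star (f a))" for f :: "_ \<Rightarrow> 'a::rch_algebra"
  by (induction S rule: infinite_finite_induct) (simp_all add: star_add star_zero)

lemma mult_star_self: "x * star x = (norm x)\<^sup>2 *\<^sub>R 1" for x :: "'a::rch_algebra"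
proof -
  have "x * star x = star x * x" by (simp add: star_eq algebra_simps)
  then show ?thesis by (simp add: star_mult_self)
qed

lemma norm_star: "norm (star x) = norm x" for x :: "'a::rch_algebra"
proof (cases "x = 0")
  case False
  have "norm (star x) * norm x = norm x * norm x"
    using arg_cong[OF star_mult_self[of x], of norm] by (simp add: norm_mult power2_eq_square)
  then show ?thesis using False by simp
qed (simp add: star_zero)

text \<open>
  Multiplication need not commute, but real parts of products do; this is what makes the real part
  of the trace cyclic.
\<close>

lemma inner_one_mult_commute: "inner 1 (x * y) = inner 1 (y * x)" for x y :: "'a::rch_algebra"
proof -
  have "inner 1 (x * y) = inner (star x) y" for x y :: 'a
    using inner_eq_inner_1_star[of "star x" y] by (simp add: star_star)
  moreover have "inner (star x) y = inner (star y) x"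
    by (simp add: star_eq inner_diff_left inner_diff_right inner_commute)
  ultimately show ?thesis by simp
qed

lemma adjoint_nth: "adjoint_matrix A $ a $ b = star (A $ b $ a)"
  by (simp add: adjoint_matrix_def)

lemma mult_nth: "(A ** B) $ a $ b = (\<Sum>c\<in>UNIV. A $ a $ c * B $ c $ b)"
  by (simp add: matrix_matrix_mult_def)

lemma mat_one_nth: "mat 1 $ a $ b = (if a = b then 1 else 0)"
  by (simp add: mat_def)

lemma adjoint_adjoint [simp]: "adjoint_matrix (adjoint_matrix A) = A"
  by (simp add: vec_eq_iff adjoint_nth star_star)

lemma adjoint_mat_one [simp]: "adjoint_matrix (mat 1) = mat 1"
  by (simp add: vec_eq_iff adjoint_nth mat_one_nth star_one star_zero)

lemma adjoint_add: "adjoint_matrix (A + B) = adjoint_matrix A + adjoint_matrix B"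
  by (simp add: vec_eq_iff adjoint_nth star_add)

lemma adjoint_diff: "adjoint_matrix (A - B) = adjoint_matrix A - adjoint_matrix B"
  by (simp add: vec_eq_iff adjoint_nth star_diff)

lemma adjoint_scaleR: "adjoint_matrix (r *\<^sub>R A) = r *\<^sub>R adjoint_matrix A"
  by (simp add: vec_eq_iff adjoint_nth star_scaleR)

lemma adjoint_mult: "adjoint_matrix (A ** B) = adjoint_matrix B ** adjoint_matrix A"
  by (simp add: vec_eq_iff adjoint_nth mult_nth star_sum star_mult)

lemma linear_adjoint: "linear adjoint_matrix"
  by (rule linearI) (simp_all add: adjoint_add adjoint_scaleR)

lemma bilinear_matrix_mult:
  "bilinear ((**) :: 'a::rch_algebra^'n^'n \<Rightarrow> 'a^'n^'n \<Rightarrow> 'a^'n^'n)"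
  unfolding bilinear_def
  by (auto intro!: linearI simp: vec_eq_iff mult_nth distrib_left distrib_right sum.distrib
      scaleR_sum_right)

lemmas bounded_bilinear_matrix_mult =
  bilinear_matrix_mult[unfolded bilinear_conv_bounded_bilinear]

lemmas matrix_left_diff = bounded_bilinear.diff_left[OF bounded_bilinear_matrix_mult]
lemmas matrix_right_diff = bounded_bilinear.diff_right[OF bounded_bilinear_matrix_mult]
lemmas matrix_left_add = bounded_bilinear.add_left[OF bounded_bilinear_matrix_mult]
lemmas matrix_right_add = bounded_bilinear.add_right[OF bounded_bilinear_matrix_mult]
lemmas matrix_left_scaleR = bounded_bilinear.scaleR_left[OF bounded_bilinear_matrix_mult]
lemmas matrix_right_scaleR = bounded_bilinear.scaleR_right[OF bounded_bilinear_matrix_mult]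
lemmas matrix_algebra = matrix_left_diff matrix_right_diff matrix_left_add matrix_right_add
  matrix_left_scaleR matrix_right_scaleR

lemmas continuous_on_matrix_mult [continuous_intros] =
  bounded_bilinear.continuous_on[OF bounded_bilinear_matrix_mult]

lemma continuous_on_adjoint [continuous_intros]:
  "continuous_on S g \<Longrightarrow> continuous_on S (\<lambda>x. adjoint_matrix (g x :: 'a::rch_algebra^'n^'n))"
  using bounded_linear.continuous_on[OF linear_adjoint[unfolded linear_conv_bounded_linear]] by blast

text \<open>
  Determinants are of no use over a noncommutative algebra. Instead, multiplication by \<open>A\<close> is a
  real linear map on a finite-dimensional space of matrices; it is surjective, hence injective.
\<close>

lemma left_inverse_of_right_inverse:
  fixes A B :: "'a::rch_algebra^'n^'n"
  assumes "A ** B = mat 1"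
  shows "B ** A = mat 1"
proof -
  have lin: "linear (\<lambda>C :: 'a^'n^'n. A ** C)"
    using bilinear_matrix_mult by (auto simp: bilinear_def)
  have "surj (\<lambda>C :: 'a^'n^'n. A ** C)"
    by (rule surjI[of _ "\<lambda>C. B ** C"]) (simp add: matrix_mul_assoc assms)
  then have "inj (\<lambda>C :: 'a^'n^'n. A ** C)"
    using lin linear_surjective_imp_injective by blast
  moreover have "A ** (B ** A) = A ** mat 1"
    by (simp add: matrix_mul_assoc assms)
  ultimately show ?thesis by (simp add: inj_def)
qed

lemma inner_mult_left_adjoint:
  "inner A (B ** C) = inner (adjoint_matrix B ** A) C" for A B C :: "'a::rch_algebra^'n^'n"
  by (simp add: inner_matrix_eq_Re_trace adjoint_mult matrix_mul_assoc)

lemma Re_trace_mult_commute: "Re_trace (A ** B) = Re_trace (B ** A)" for A B :: "'a::rch_algebra^'n^'n"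
proof -
  have "Re_trace (A ** B) = (\<Sum>a\<in>UNIV. \<Sum>b\<in>UNIV. inner 1 (A $ a $ b * B $ b $ a))"
    by (simp add: Re_trace_def trace_def mult_nth inner_sum_right)
  also have "\<dots> = (\<Sum>b\<in>UNIV. \<Sum>a\<in>UNIV. inner 1 (B $ b $ a * A $ a $ b))"
    by (subst sum.swap) (simp add: inner_one_mult_commute)
  also have "\<dots> = Re_trace (B ** A)"
    by (simp add: Re_trace_def trace_def mult_nth inner_sum_right)
  finally show ?thesis .
qed

lemma inner_mult_right_adjoint:
  "inner A (C ** B) = inner (A ** adjoint_matrix B) C" for A B C :: "'a::rch_algebra^'n^'n"
  by (metis (no_types) inner_matrix_eq_Re_trace adjoint_mult adjoint_adjoint matrix_mul_assoc
      Re_trace_mult_commute)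

lemma inner_adjoint: "inner (adjoint_matrix A) (adjoint_matrix B) = inner A B"
  for A B :: "'a::rch_algebra^'n^'n"
  by (metis inner_commute inner_matrix_eq_Re_trace adjoint_adjoint Re_trace_mult_commute)

text \<open>
  Taking adjoints preserves the inner product, fixes \<open>H\<close> and negates \<open>W\<close>.
\<close>

lemma inner_hermitian_skew:
  fixes H W :: "'a::rch_algebra^'n^'n"
  assumes "adjoint_matrix H = H" and "adjoint_matrix W = - W"
  shows "inner H W = 0"
  using inner_adjoint[of H W] assms by simp

lemma inner_self_skew_mult:
  fixes W B :: "'a::rch_algebra^'n^'n"
  assumes "adjoint_matrix W = - W"
  shows "inner B (W ** B) = 0"
proof -
  have "inner B (W ** B) = inner (B ** adjoint_matrix B) W"
    by (rule inner_mult_right_adjoint)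
  also have "\<dots> = 0"
    using assms by (intro inner_hermitian_skew) (simp_all add: adjoint_mult)
  finally show ?thesis .
qed

lemma height_eq_inner: "height X A = inner X A"
  by (simp add: height_def inner_matrix_eq_Re_trace)

lemma unitary_left: "A \<in> unitary_group \<Longrightarrow> adjoint_matrix A ** A = mat 1"
  and unitary_right: "A \<in> unitary_group \<Longrightarrow> A ** adjoint_matrix A = mat 1"
  by (auto simp: unitary_group_def left_inverse_of_right_inverse)

lemma mat_one_unitary: "mat 1 \<in> unitary_group"
  by (simp add: unitary_group_def)

lemma unitary_adjoint: "A \<in> unitary_group \<Longrightarrow> adjoint_matrix A \<in> unitary_group"
  by (simp add: unitary_group_def left_inverse_of_right_inverse)

lemma unitary_mult:
  assumes "A \<in> unitary_group" and "B \<in> unitary_group"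
  shows "A ** B \<in> unitary_group"
proof -
  have "A ** B ** adjoint_matrix (A ** B) = A ** (B ** adjoint_matrix B) ** adjoint_matrix A"
    by (simp add: adjoint_mult matrix_mul_assoc)
  then show ?thesis using assms by (simp add: unitary_group_def)
qed

lemma unitary_cancel:
  assumes "A \<in> unitary_group"
  shows "adjoint_matrix A ** (A ** B) = B" and "A ** (adjoint_matrix A ** B) = B"
    and "B ** A ** adjoint_matrix A = B" and "B ** adjoint_matrix A ** A = B"
  using assms
  by (simp_all add: matrix_mul_assoc unitary_left unitary_right)
    (simp_all add: matrix_mul_assoc[symmetric] unitary_left unitary_right)

lemma norm_unitary_mult: "A \<in> unitary_group \<Longrightarrow> norm (A ** B) = norm B"
  for A B :: "'a::rch_algebra^'n^'n"
  by (simp add: norm_eq_sqrt_inner inner_mult_left_adjoint unitary_cancel)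

lemma norm_mult_unitary: "A \<in> unitary_group \<Longrightarrow> norm (B ** A) = norm B"
  for A B :: "'a::rch_algebra^'n^'n"
  using inner_mult_right_adjoint[of "B ** A" B A] by (simp add: norm_eq_sqrt_inner unitary_cancel)

lemma compact_unitary_group: "compact (unitary_group :: ('a::rch_algebra^'n^'n) set)"
proof -
  let ?G = "unitary_group :: ('a^'n^'n) set"
  have "closed ?G"
    unfolding unitary_group_def by (intro closed_Collect_eq continuous_intros)
  moreover have "norm A = norm (mat 1 :: 'a^'n^'n)" if "A \<in> ?G" for A
    using norm_unitary_mult[OF that, of "mat 1"] by simp
  then have "bounded ?G" by (intro boundedI[of _ "norm (mat 1 :: 'a^'n^'n)"]) auto
  ultimately show ?thesis by (simp add: compact_eq_bounded_closed)
qed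

section \<open>A continuous ascent step on the group\<close>

text \<open>
  The gradient of the height function on the group at \<open>A\<close>, which is the tangential part of \<open>X\<close>, is
  half of \<open>gradient_generator X A ** A\<close>.
\<close>

definition gradient_generator :: "'a::rch_algebra^'n^'n \<Rightarrow> 'a^'n^'n \<Rightarrow> 'a^'n^'n" where
  "gradient_generator X A = X ** adjoint_matrix A - A ** adjoint_matrix X"

lemma gradient_generator_skew:
  "adjoint_matrix (gradient_generator X A) = - gradient_generator X A"
  by (simp add: gradient_generator_def adjoint_diff adjoint_mult)

text \<open>
  If \<open>B = r W B\<close> then the square norm of \<open>B\<close> equals \<open>r\<close> times the inner product of \<open>B\<close> and \<open>W B\<close>,
  which is zero; so multiplication by \<open>mat 1 - r *\<^sub>R W\<close> is injective, hence bijective.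
\<close>

lemma mat_one_minus_skew:
  fixes W :: "'a::rch_algebra^'n^'n"
  assumes skew: "adjoint_matrix W = - W"
  obtains R where "(mat 1 - r *\<^sub>R W) ** R = mat 1" and "R ** (mat 1 - r *\<^sub>R W) = mat 1"
proof -
  let ?M = "mat 1 - r *\<^sub>R W"
  have lin: "linear (\<lambda>B :: 'a^'n^'n. ?M ** B)"
    using bilinear_matrix_mult by (auto simp: bilinear_def)
  have "B = 0" if "?M ** B = 0" for B :: "'a^'n^'n"
  proof -
    have "B = r *\<^sub>R (W ** B)"
      using that by (simp add: matrix_algebra)
    then have "inner B B = inner B (r *\<^sub>R (W ** B))" by simp
    also have "\<dots> = 0" by (simp add: inner_self_skew_mult[OF skew])
    finally show ?thesis by simp
  qed
  then have "inj (\<lambda>B :: 'a^'n^'n. ?M ** B)"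
    using linear_injective_0[OF lin] by blast
  then have "surj (\<lambda>B :: 'a^'n^'n. ?M ** B)"
    using lin linear_injective_imp_surjective by blast
  then obtain R where "?M ** R = mat 1" by (metis surjD)
  then show ?thesis using that left_inverse_of_right_inverse by blast
qed

text \<open>
  With \<open>W = gradient_generator X A\<close>, the solution \<open>B\<close> is the Cayley transform of \<open>r W\<close> applied to \<open>A\<close>.
  For small \<open>r > 0\<close> it leaves \<open>A\<close> in the direction of the gradient, and it stays in the group exactly.
  The equation is kept free of inverses so that its solution set is visibly closed.
\<close>

definition cayley_equation ::
    "'a::rch_algebra^'n^'n \<Rightarrow> real \<Rightarrow> 'a^'n^'n \<Rightarrow> 'a^'n^'n \<Rightarrow> bool" where
  "cayley_equation X r A B \<longleftrightarrow>
     (mat 1 - r *\<^sub>R gradient_generator X A) ** B = (mat 1 + r *\<^sub>R gradient_generator X A) ** A"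

text \<open>
  Since \<open>W\<close> is skew, the two factors \<open>mat 1 - r *\<^sub>R W\<close> and \<open>mat 1 + r *\<^sub>R W\<close> are adjoint to each other
  and commute, which makes the solution unitary.
\<close>

lemma
  fixes X A :: "'a::rch_algebra^'n^'n"
  assumes A: "A \<in> unitary_group"
  shows cayley_equation_solvable: "\<exists>B\<in>unitary_group. cayley_equation X r A B"
    and cayley_equation_unique: "cayley_equation X r A B \<Longrightarrow> cayley_equation X r A B' \<Longrightarrow> B = B'"
proof -
  let ?W = "gradient_generator X A"
  let ?M = "mat 1 - r *\<^sub>R ?W" and ?N = "mat 1 + r *\<^sub>R ?W"
  obtain R where R: "?M ** R = mat 1" "R ** ?M = mat 1"
    using mat_one_minus_skew[OF gradient_generator_skew] by metis
  have adj: "adjoint_matrix ?M = ?N" "adjoint_matrix ?N = ?M"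
    by (simp_all add: adjoint_add adjoint_diff adjoint_scaleR gradient_generator_skew)
  have comm: "?N ** ?M = ?M ** ?N"
    by (simp add: matrix_algebra scaleR_diff_right scaleR_add_right)
  have NR: "?N ** adjoint_matrix R = mat 1"
    using arg_cong[OF R(2), of adjoint_matrix] by (simp add: adjoint_mult adj)
  let ?B = "R ** (?N ** A)"
  have "?B ** adjoint_matrix ?B = R ** (?N ** (A ** adjoint_matrix A) ** ?M) ** adjoint_matrix R"
    by (simp add: adjoint_mult adj matrix_mul_assoc)
  also have "\<dots> = R ** (?N ** ?M) ** adjoint_matrix R"
    using A by (simp add: unitary_right)
  also have "\<dots> = (R ** ?M) ** (?N ** adjoint_matrix R)"
    unfolding comm by (simp only: matrix_mul_assoc)
  also have "\<dots> = mat 1" unfolding R NR by simp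
  finally have "?B \<in> unitary_group" by (simp add: unitary_group_def)
  moreover have "cayley_equation X r A ?B"
    unfolding cayley_equation_def matrix_mul_assoc[of ?M] R by simp
  ultimately show "\<exists>B\<in>unitary_group. cayley_equation X r A B" by blast
  have "B = R ** (?N ** A)" if "cayley_equation X r A B" for B
  proof -
    have "R ** (?M ** B) = R ** (?N ** A)"
      using that by (simp add: cayley_equation_def)
    then show ?thesis by (simp add: matrix_mul_assoc R)
  qed
  then show "cayley_equation X r A B \<Longrightarrow> cayley_equation X r A B' \<Longrightarrow> B = B'" by metis
qed

definition cayley_step :: "'a::rch_algebra^'n^'n \<Rightarrow> real \<Rightarrow> 'a^'n^'n \<Rightarrow> 'a^'n^'n" where
  "cayley_step X r A = (SOME B. B \<in> unitary_group \<and> cayley_equation X r A B)"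

lemma cayley_step:
  assumes "A \<in> unitary_group"
  shows "cayley_step X r A \<in> unitary_group" and "cayley_equation X r A (cayley_step X r A)"
proof -
  have "\<exists>B. B \<in> unitary_group \<and> cayley_equation X r A B"
    using cayley_equation_solvable[OF assms] by blast
  from someI_ex[OF this]
  show "cayley_step X r A \<in> unitary_group" "cayley_equation X r A (cayley_step X r A)"
    by (auto simp: cayley_step_def)
qed

lemma cayley_step_eq_iff:
  "A \<in> unitary_group \<Longrightarrow> cayley_step X r A = B \<longleftrightarrow> cayley_equation X r A B"
  using cayley_step cayley_equation_unique by metis

text \<open>
  The graph is closed, being given by equations between continuous functions, and the values lie in
  the compact group.
\<close>

lemma continuous_on_cayley_step:
  fixes X :: "'a::rch_algebra^'n^'n"
  shows "continuous_on ({0..1} \<times> unitary_group) (\<lambda>(u, A). cayley_step X (u * s) A)"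
proof (rule continuous_from_closed_graph)
  let ?G = "unitary_group :: ('a^'n^'n) set"
  let ?E = "{p. cayley_equation X (fst (fst p) * s) (snd (fst p)) (snd p)}"
  show "compact ?G" by (rule compact_unitary_group)
  show "(\<lambda>(u, A). cayley_step X (u * s) A) \<in> {0..1} \<times> ?G \<rightarrow> ?G"
    by (auto simp: cayley_step)
  have "closed ?E"
    unfolding cayley_equation_def gradient_generator_def
    by (intro closed_Collect_eq continuous_intros)
  moreover have "closed (({0..1::real} \<times> ?G) \<times> (UNIV :: ('a^'n^'n) set))"
    by (intro closed_Times compact_imp_closed[OF compact_unitary_group]) auto
  ultimately have "closed (({0..1} \<times> ?G) \<times> UNIV \<inter> ?E)" by (rule closed_Int[rotated])
  also have "({0..1} \<times> ?G) \<times> UNIV \<inter> ?E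
      = (\<lambda>x. (x, (\<lambda>(u, A). cayley_step X (u * s) A) x)) ` ({0..1} \<times> ?G)"
    by (auto simp: image_iff cayley_step cayley_step_eq_iff[symmetric])
  finally show "closed ((\<lambda>x. (x, (\<lambda>(u, A). cayley_step X (u * s) A) x)) ` ({0..1} \<times> ?G))" .
qed

lemma homotopic_cayley_step:
  fixes X :: "'a::rch_algebra^'n^'n"
  shows "homotopic_with_canon (\<lambda>_. True) unitary_group unitary_group (\<lambda>A. A) (cayley_step X s)"
proof (subst homotopic_with, simp, intro exI[of _ "\<lambda>(u, A). cayley_step X (u * s) A"] conjI ballI allI)
  show "continuous_map (prod_topology (top_of_set {0..1}) (top_of_set unitary_group))
     (top_of_set unitary_group) (\<lambda>(u, A). cayley_step X (u * s) A)"
    using continuous_on_cayley_step[of X s]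
    by (auto simp: cayley_step simp flip: subtopology_Times euclidean_product_topology)
qed (simp_all add: cayley_step_eq_iff cayley_equation_def)

text \<open>
  The step satisfies \<open>B - A = s (W A + W B)\<close>. The inner product of \<open>X\<close> with \<open>W A + W B\<close> is twice that
  with \<open>W A\<close>, which gives the square norm of \<open>W\<close>, plus an error from \<open>W (B - A)\<close>, which is of order
  \<open>s\<close> times that square. So the gain is of first order in \<open>s\<close> and the loss of second order.
\<close>

lemma height_cayley_step:
  fixes X A B :: "'a::rch_algebra^'n^'n"
  assumes A: "A \<in> unitary_group" and B: "B \<in> unitary_group" and eq: "cayley_equation X s A B"
    and K: "\<And>(P :: 'a^'n^'n) (Q :: 'a^'n^'n). norm (P ** Q) \<le> K * norm P * norm Q" "K \<ge> 0" and s: "s \<ge> 0"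
  shows "height X A + s * (norm (gradient_generator X A))\<^sup>2 * (1 - 2 * s * K * norm X) \<le> height X B"
proof -
  let ?W = "gradient_generator X A"
  have BA: "B - A = s *\<^sub>R (?W ** A + ?W ** B)"
    using eq by (simp add: cayley_equation_def matrix_algebra algebra_simps)
  have "norm (B - A) \<le> s * (norm (?W ** A) + norm (?W ** B))"
    unfolding BA norm_scaleR using s by (simp add: mult_left_mono norm_triangle_ineq)
  then have nBA: "norm (B - A) \<le> 2 * s * norm ?W"
    using A B by (simp add: norm_mult_unitary)
  \<comment> \<open>Only the skew part of \<open>X ** adjoint_matrix A\<close>, which is half of \<open>W\<close>, pairs nontrivially
    with \<open>W\<close>.\<close>
  have W: "2 * inner X (?W ** A) = (norm ?W)\<^sup>2"
  proof -
    have "inner X (?W ** A) = inner (X ** adjoint_matrix A) ?W"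
      by (rule inner_mult_right_adjoint)
    moreover have "inner (A ** adjoint_matrix X) ?W = - inner (X ** adjoint_matrix A) ?W"
      using inner_adjoint[of "X ** adjoint_matrix A" ?W]
      by (simp add: adjoint_mult gradient_generator_skew)
    ultimately have "2 * inner X (?W ** A)
        = inner (X ** adjoint_matrix A - A ** adjoint_matrix X) ?W"
      by (simp add: inner_diff_left)
    then show ?thesis
      by (simp add: gradient_generator_def[symmetric] power2_norm_eq_inner)
  qed
  have "\<bar>inner X (?W ** (B - A))\<bar> \<le> norm X * norm (?W ** (B - A))"
    by (rule Cauchy_Schwarz_ineq2)
  also have "\<dots> \<le> norm X * (K * norm ?W * norm (B - A))"
    by (intro mult_left_mono K(1)) auto
  also have "\<dots> \<le> norm X * (K * norm ?W * (2 * s * norm ?W))"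
    using nBA K(2) by (intro mult_left_mono) auto
  finally have err: "- (2 * s * K * norm X * (norm ?W)\<^sup>2) \<le> inner X (?W ** (B - A))"
    by (simp add: power2_eq_square algebra_simps)
  have "height X B - height X A = inner X (B - A)"
    by (simp add: height_eq_inner inner_diff_right)
  also have "\<dots> = s * (2 * inner X (?W ** A) + inner X (?W ** (B - A)))"
    by (subst BA) (simp add: matrix_right_diff inner_add_right inner_diff_right)
  also have "\<dots> \<ge> s * ((norm ?W)\<^sup>2 - 2 * s * K * norm X * (norm ?W)\<^sup>2)"
    unfolding W using err s by (intro mult_left_mono) auto
  finally show ?thesis by (simp add: algebra_simps)
qed

lemma ascent_step_exists:
  fixes X :: "'a::rch_algebra^'n^'n"
  obtains \<phi> where
    "homotopic_with_canon (\<lambda>_. True) unitary_group unitary_group (\<lambda>A. A) \<phi>"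
    "\<And>A. A \<in> unitary_group \<Longrightarrow> height X A \<le> height X (\<phi> A)"
    "\<And>A. A \<in> unitary_group \<Longrightarrow> height X (\<phi> A) = height X A \<Longrightarrow> gradient_generator X A = 0"
proof -
  obtain K where K: "K > 0" "\<And>(P :: 'a^'n^'n) (Q :: 'a^'n^'n). norm (P ** Q) \<le> K * norm P * norm Q"
    using bilinear_bounded_pos[OF bilinear_matrix_mult] by metis
  \<comment> \<open>The product \<open>2 * s * K * norm X\<close> must stay below 1; adding 1 to \<open>norm X\<close> avoids division
    by zero.\<close>
  define s where "s = 1 / (4 * K * (norm X + 1))"
  have s: "s > 0" "1 - 2 * s * K * norm X > 0"
    using K(1) by (auto simp: s_def field_simps add_pos_nonneg)
  have gain: "height X A + s * (norm (gradient_generator X A))\<^sup>2 * (1 - 2 * s * K * norm X)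
      \<le> height X (cayley_step X s A)" if "A \<in> unitary_group" for A
    using that K s(1) by (intro height_cayley_step) (auto simp: cayley_step)
  show ?thesis
  proof (rule that[of "cayley_step X s"])
    fix A :: "'a^'n^'n" assume A: "A \<in> unitary_group"
    have "0 \<le> s * (norm (gradient_generator X A))\<^sup>2 * (1 - 2 * s * K * norm X)"
      using s by simp
    then show "height X A \<le> height X (cayley_step X s A)" using gain[OF A] by linarith
    assume "height X (cayley_step X s A) = height X A"
    then have "s * (norm (gradient_generator X A))\<^sup>2 * (1 - 2 * s * K * norm X) \<le> 0"
      using gain[OF A] by linarith
    then show "gradient_generator X A = 0" using s by (simp add: mult_le_0_iff)
  qed (rule homotopic_cayley_step)
qed

text \<open>
  A velocity \<open>v\<close> at \<open>A\<close> makes \<open>v ** adjoint_matrix A\<close> skew, by differentiating the defining equation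
  of the group, while the vanishing of the generator says that \<open>X ** adjoint_matrix A\<close> is hermitian.
  These two are orthogonal, so \<open>v\<close> is orthogonal to \<open>X\<close>, and the height has derivative zero along \<open>v\<close>.
\<close>

lemma critical_if_generator_zero:
  fixes X A :: "'a::rch_algebra^'n^'n"
  assumes A: "A \<in> unitary_group" and W0: "gradient_generator X A = 0"
  shows "A \<in> critical_set unitary_group (height X)"
  unfolding critical_set_def
proof (intro CollectI conjI allI impI A)
  fix \<gamma> :: "real \<Rightarrow> 'a^'n^'n" and v
  assume "(\<forall>s. \<gamma> s \<in> unitary_group) \<and> \<gamma> 0 = A \<and> (\<gamma> has_vector_derivative v) (at 0)"
  then have \<gamma>: "\<And>s. \<gamma> s \<in> unitary_group" "\<gamma> 0 = A" "(\<gamma> has_vector_derivative v) (at 0)"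
    by auto
  have "((\<lambda>s. adjoint_matrix (\<gamma> s)) has_vector_derivative adjoint_matrix v) (at 0)"
    using linear_adjoint[unfolded linear_conv_bounded_linear] \<gamma>(3)
    by (rule bounded_linear.has_vector_derivative)
  from bounded_bilinear.has_vector_derivative[OF bounded_bilinear_matrix_mult \<gamma>(3) this]
  have "((\<lambda>s. \<gamma> s ** adjoint_matrix (\<gamma> s)) has_vector_derivative
      (A ** adjoint_matrix v + v ** adjoint_matrix A)) (at 0)"
    by (simp add: \<gamma>(2))
  moreover have "(\<lambda>s. \<gamma> s ** adjoint_matrix (\<gamma> s)) = (\<lambda>s. mat 1)"
    using \<gamma>(1) by (simp add: unitary_right fun_eq_iff)
  ultimately have "A ** adjoint_matrix v + v ** adjoint_matrix A = 0"
    using vector_derivative_unique_at has_vector_derivative_const by metis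
  then have "adjoint_matrix (v ** adjoint_matrix A) = - (v ** adjoint_matrix A)"
    by (simp add: adjoint_mult eq_neg_iff_add_eq_0)
  moreover have "adjoint_matrix (X ** adjoint_matrix A) = X ** adjoint_matrix A"
    using W0 by (simp add: gradient_generator_def adjoint_mult)
  ultimately have "inner (X ** adjoint_matrix A) (v ** adjoint_matrix A) = 0"
    by (intro inner_hermitian_skew)
  moreover have "inner (X ** adjoint_matrix A) (v ** adjoint_matrix A)
      = inner X (v ** adjoint_matrix A ** A)"
    by (rule inner_mult_right_adjoint[symmetric])
  ultimately have "inner X v = 0" by (simp add: unitary_cancel[OF A])
  moreover have "((\<lambda>s. inner X (\<gamma> s)) has_vector_derivative inner X v) (at 0)"
    using bounded_linear_inner_right \<gamma>(3) by (rule bounded_linear.has_vector_derivative)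
  ultimately show "((\<lambda>s. height X (\<gamma> s)) has_real_derivative 0) (at 0)"
    by (simp add: height_eq_inner has_real_derivative_iff_has_vector_derivative)
qed

section \<open>Normal form of hermitian involutions\<close>

text \<open>
  A matrix on the index set \<open>S\<close>, completed by the identity outside \<open>S\<close>. The completion is faithful and
  compatible with products and adjoints, so that statements about blocks become statements about
  square matrices of full size.
\<close>

definition embed_block :: "'n set \<Rightarrow> ('n \<Rightarrow> 'n \<Rightarrow> 'a::rch_algebra) \<Rightarrow> 'a^'n^'n" where
  "embed_block S P = (\<chi> a b. if a \<in> S \<and> b \<in> S then P a b else if a = b then 1 else 0)"

lemma embed_block_nth:
  "embed_block S P $ a $ b = (if a \<in> S \<and> b \<in> S then P a b else if a = b then 1 else 0)"
  by (simp add: embed_block_def)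

lemma embed_block_eq_iff: "embed_block S P = embed_block S Q \<longleftrightarrow> mat_eq_on S P Q"
  by (auto simp: vec_eq_iff embed_block_nth mat_eq_on_def)

lemma embed_block_one: "embed_block S mat_one_on = mat 1"
  by (simp add: vec_eq_iff embed_block_nth mat_one_on_def mat_one_nth)

lemma embed_block_star: "embed_block S (mat_star_on P) = adjoint_matrix (embed_block S P)"
  by (simp add: vec_eq_iff embed_block_nth mat_star_on_def adjoint_nth star_one star_zero)

lemma embed_block_mult:
  fixes P Q :: "'n::finite \<Rightarrow> 'n \<Rightarrow> 'a::rch_algebra"
  shows "embed_block S (mat_mult_on S P Q) = embed_block S P ** embed_block S Q"
proof -
  have "embed_block S (mat_mult_on S P Q) $ a $ b = (embed_block S P ** embed_block S Q) $ a $ b" for a b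
  proof (cases "a \<in> S \<and> b \<in> S")
    case True
    have "(\<Sum>c\<in>S. P a c * Q c b) = (\<Sum>c\<in>UNIV. embed_block S P $ a $ c * embed_block S Q $ c $ b)"
      using True by (intro sum.mono_neutral_cong_left) (auto simp: embed_block_nth)
    then show ?thesis using True by (simp add: embed_block_nth mat_mult_on_def mult_nth)
  next
    case False
    show ?thesis
    proof (cases "a \<in> S")
      case True
      have "(\<Sum>c\<in>UNIV. embed_block S P $ a $ c * embed_block S Q $ c $ b) = 0"
        using False True by (intro sum.neutral) (auto simp: embed_block_nth)
      then show ?thesis using True False by (auto simp: embed_block_nth mult_nth)
    next
      case notS: False
      have "(\<Sum>c\<in>UNIV. embed_block S P $ a $ c * embed_block S Q $ c $ b)
          = (\<Sum>c\<in>UNIV. if c = a then embed_block S Q $ c $ b else 0)"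
        using notS by (intro sum.cong) (auto simp: embed_block_nth)
      then show ?thesis using notS by (simp add: embed_block_nth mult_nth)
    qed
  qed
  then show ?thesis by (simp add: vec_eq_iff)
qed

lemma unitary_on_iff: "P \<in> unitary_on S \<longleftrightarrow> embed_block S P \<in> unitary_group"
  for P :: "'n::finite \<Rightarrow> 'n \<Rightarrow> 'a::rch_algebra"
  by (simp add: unitary_on_def unitary_group_def embed_block_eq_iff[symmetric] embed_block_mult
      embed_block_star embed_block_one)

lemma conjugate_on_iff:
  fixes A E :: "'n::finite \<Rightarrow> 'n \<Rightarrow> 'a::rch_algebra"
  shows "conjugate_on S A E \<longleftrightarrow> (\<exists>P. embed_block S P \<in> unitary_group \<and>
    embed_block S A = embed_block S P ** embed_block S E ** adjoint_matrix (embed_block S P))"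
  by (auto simp: conjugate_on_def unitary_on_iff embed_block_eq_iff[symmetric] embed_block_mult
      embed_block_star)

definition supported_on :: "'n set \<Rightarrow> 'a::rch_algebra^'n^'n \<Rightarrow> bool" where
  "supported_on S A \<longleftrightarrow> embed_block S (\<lambda>a b. A $ a $ b) = A"

lemma supported_on_iff:
  "supported_on S A \<longleftrightarrow> (\<forall>a b. a \<notin> S \<or> b \<notin> S \<longrightarrow> A $ a $ b = mat 1 $ a $ b)"
  by (auto simp: supported_on_def vec_eq_iff embed_block_nth mat_one_nth)

lemma supported_on_embed_block: "supported_on S (embed_block S P)"
  by (auto simp: supported_on_iff embed_block_nth mat_one_nth)

lemma supported_on_mult:
  "supported_on S A \<Longrightarrow> supported_on S B \<Longrightarrow> supported_on S (A ** B)"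
  for A B :: "'a::rch_algebra^'n^'n"
  by (metis supported_on_def supported_on_embed_block embed_block_mult)

lemma supported_on_adjoint:
  "supported_on S A \<Longrightarrow> supported_on S (adjoint_matrix A)"
  by (metis supported_on_def supported_on_embed_block embed_block_star)

lemma supported_on_mono: "supported_on T A \<Longrightarrow> T \<subseteq> S \<Longrightarrow> supported_on S A"
  unfolding supported_on_iff by blast

text \<open>
  The reflection in the hyperplane orthogonal to \<open>e - v\<close>, where \<open>e\<close> is the basis vector at \<open>a\<close>,
  exchanges \<open>e\<close> and \<open>v\<close>, provided that their product \<open>v a\<close> is real.
\<close>

lemma householder:
  fixes v :: "'n::finite \<Rightarrow> 'a::rch_algebra"
  assumes unit: "(\<Sum>b\<in>UNIV. (norm (v b))\<^sup>2) = 1" and real: "v a = \<rho> *\<^sub>R 1"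
    and a: "a \<in> S" and supp: "\<And>b. b \<notin> S \<Longrightarrow> v b = 0"
  obtains Q :: "'a^'n^'n" where "Q \<in> unitary_group" and "supported_on S Q" and "\<And>b. Q $ b $ a = v b"
proof -
  define w where "w b = (mat 1 :: 'a^'n^'n) $ b $ a - v b" for b
  define N where "N = (\<Sum>b\<in>UNIV. (norm (w b))\<^sup>2)"
  have wa: "w a = (1 - \<rho>) *\<^sub>R 1" by (simp add: w_def mat_one_nth real algebra_simps)
  have nwa: "norm (w a) = \<bar>1 - \<rho>\<bar>" by (simp only: wa norm_scaleR) simp
  have N: "N = 2 * (1 - \<rho>)"
  proof -
    have "N = (norm (w a))\<^sup>2 + (\<Sum>b\<in>UNIV - {a}. (norm (w b))\<^sup>2)"
      unfolding N_def by (rule sum.remove) auto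
    also have "(\<Sum>b\<in>UNIV - {a}. (norm (w b))\<^sup>2) = (\<Sum>b\<in>UNIV - {a}. (norm (v b))\<^sup>2)"
      by (intro sum.cong) (auto simp: w_def mat_one_nth)
    also have "\<dots> = 1 - (norm (v a))\<^sup>2"
      using unit sum.remove[of UNIV a "\<lambda>b. (norm (v b))\<^sup>2"] by simp
    finally show ?thesis by (simp add: nwa real power2_eq_square algebra_simps)
  qed
  show ?thesis
  proof (cases "N = 0")
    case True
    then have "\<forall>b\<in>UNIV. (norm (w b))\<^sup>2 = 0"
      unfolding N_def by (subst sum_nonneg_eq_0_iff[symmetric]) auto
    then have "mat 1 $ b $ a = v b" for b by (simp add: w_def)
    then show ?thesis
      by (intro that[of "mat 1"]) (simp_all add: mat_one_unitary supported_on_iff)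
  next
    case False
    define Z :: "'a^'n^'n" where "Z = (\<chi> b c. w b * star (w c))"
    \<comment> \<open>The reflection is \<open>I - 2 w w\<^sup>* / N\<close>, where \<open>N\<close> is the square norm of \<open>w = e - v\<close>.\<close>
    define \<kappa> where "\<kappa> = 2 / N"
    let ?Q = "mat 1 - \<kappa> *\<^sub>R Z"
    have Zadj: "adjoint_matrix Z = Z"
      by (simp add: vec_eq_iff adjoint_nth Z_def star_mult star_star)
    have ZZ: "Z ** Z = N *\<^sub>R Z"
    proof -
      have "(Z ** Z) $ b $ c = (N *\<^sub>R Z) $ b $ c" for b c
      proof -
        have "(Z ** Z) $ b $ c = (\<Sum>d\<in>UNIV. w b * (star (w d) * w d) * star (w c))"
          by (simp add: mult_nth Z_def mult.assoc)
        also have "\<dots> = (\<Sum>d\<in>UNIV. (norm (w d))\<^sup>2 *\<^sub>R (w b * star (w c)))"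
          by (simp add: star_mult_self)
        finally show ?thesis by (simp add: N_def Z_def scaleR_sum_left)
      qed
      then show ?thesis by (simp add: vec_eq_iff)
    qed
    have "?Q ** ?Q = mat 1 - \<kappa> *\<^sub>R Z - \<kappa> *\<^sub>R (Z - \<kappa> *\<^sub>R (Z ** Z))"
      by (simp add: matrix_left_diff matrix_right_diff matrix_left_scaleR matrix_right_scaleR)
    also have "\<kappa> *\<^sub>R (Z - \<kappa> *\<^sub>R (Z ** Z)) = (\<kappa> - \<kappa> * \<kappa> * N) *\<^sub>R Z"
      unfolding ZZ by (simp add: scaleR_diff_left scaleR_diff_right)
    also have "\<kappa> - \<kappa> * \<kappa> * N = - \<kappa>" using False by (simp add: \<kappa>_def)
    finally have "?Q ** ?Q = mat 1" by simp
    then have "?Q \<in> unitary_group"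
      by (simp add: unitary_group_def adjoint_diff adjoint_scaleR Zadj)
    moreover have "supported_on S ?Q"
    proof -
      have "w b = 0" if "b \<notin> S" for b
        using that a by (auto simp: w_def mat_one_nth supp)
      then show ?thesis by (auto simp: supported_on_iff Z_def star_zero)
    qed
    moreover have "?Q $ b $ a = v b" for b
    proof -
      have "\<kappa> * (1 - \<rho>) = 1" using False N by (simp add: \<kappa>_def)
      moreover have "\<kappa> *\<^sub>R (w b * star (w a)) = (\<kappa> * (1 - \<rho>)) *\<^sub>R w b"
        by (simp add: wa star_scaleR star_one)
      ultimately show ?thesis by (simp add: Z_def w_def)
    qed
    ultimately show ?thesis by (rule that)
  qed
qed

text \<open>
  A nonzero column of \<open>mat 1 + A\<close> is fixed by the involution \<open>A\<close>. Multiplying it from the right by a unit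
  scalar keeps it fixed and makes the prescribed coordinate \<open>v a\<close> real, as the reflection above needs.
\<close>

lemma unit_eigenvector:
  fixes A :: "'a::rch_algebra^'n^'n"
  assumes inv: "A ** A = mat 1" and supp: "supported_on S A"
    and c: "c \<in> S" and neq: "mat 1 $ b $ c + A $ b $ c \<noteq> 0"
  obtains v \<rho> where "(\<Sum>b\<in>UNIV. (norm (v b))\<^sup>2) = 1" and "v a = \<rho> *\<^sub>R 1"
    and "\<And>b. b \<notin> S \<Longrightarrow> v b = 0" and "\<And>b. (\<Sum>d\<in>UNIV. A $ b $ d * v d) = v b"
proof -
  define z where "z b = (mat 1 + A) $ b $ c" for b
  define u where "u = (if z a = 0 then 1 else star (z a) /\<^sub>R norm (z a))"
  define \<nu> where "\<nu> = sqrt (\<Sum>b\<in>UNIV. (norm (z b))\<^sup>2)"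
  have "0 < (norm (z b))\<^sup>2" using neq by (simp add: z_def)
  also have "\<dots> \<le> (\<Sum>b\<in>UNIV. (norm (z b))\<^sup>2)" by (intro member_le_sum) auto
  finally have \<nu>: "\<nu> > 0" "\<nu>\<^sup>2 = (\<Sum>b\<in>UNIV. (norm (z b))\<^sup>2)" by (auto simp: \<nu>_def)
  have u: "norm u = 1" by (simp add: u_def norm_star)
  have "A ** (mat 1 + A) = mat 1 + A" by (simp add: matrix_algebra inv)
  then have eig: "(\<Sum>d\<in>UNIV. A $ b $ d * z d) = z b" for b
    unfolding z_def mult_nth[symmetric] by simp
  show ?thesis
  proof (rule that[of "\<lambda>b. (z b * u) /\<^sub>R \<nu>" "norm (z a) / \<nu>"])
    have "(\<Sum>b\<in>UNIV. (norm ((z b * u) /\<^sub>R \<nu>))\<^sup>2) = (\<Sum>b\<in>UNIV. (norm (z b))\<^sup>2) / \<nu>\<^sup>2"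
      using \<nu>(1) by (simp add: norm_mult u power_mult_distrib sum_divide_distrib field_simps)
    also have "\<dots> = 1" using \<nu>(1) by (simp add: \<nu>(2)[symmetric])
    finally show "(\<Sum>b\<in>UNIV. (norm ((z b * u) /\<^sub>R \<nu>))\<^sup>2) = 1" .
    have "z a * u = norm (z a) *\<^sub>R 1"
      by (simp add: u_def mult_star_self power2_eq_square)
    then show "(z a * u) /\<^sub>R \<nu> = (norm (z a) / \<nu>) *\<^sub>R 1"
      by (simp add: divide_inverse mult.commute)
    show "(z b * u) /\<^sub>R \<nu> = 0" if "b \<notin> S" for b
      using that c supp by (auto simp: z_def supported_on_iff mat_one_nth)
    show "(\<Sum>d\<in>UNIV. A $ b $ d * ((z d * u) /\<^sub>R \<nu>)) = (z b * u) /\<^sub>R \<nu>" for b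
      unfolding eig[of b, symmetric]
      by (simp add: sum_distrib_right scaleR_sum_right mult.assoc)
  qed
qed

text \<open>
  Induction that removes the largest index \<open>a\<close>. If \<open>A\<close> is \<open>-1\<close> on \<open>S\<close>, it already is the signature with
  \<open>card S\<close> negative entries. Otherwise some unit vector is fixed by \<open>A\<close>, and a reflection moves it to
  the basis vector at \<open>a\<close>; the conjugate of \<open>A\<close> then splits off an entry 1 at \<open>a\<close>. As \<open>a\<close> is the last
  index, this entry is where a signature with at most \<open>card S - 1\<close> negative entries has it, so that no
  reordering is needed afterwards.
\<close>

lemma hermitian_involution_conjugate_signature:
  fixes A :: "('a::rch_algebra, 'n::{finite,linorder}) square_matrix"
  assumes "finite S" and "adjoint_matrix A = A" and "A ** A = mat 1" and "supported_on S A"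
  shows "\<exists>i\<le>card S. \<exists>P\<in>unitary_group. supported_on S P \<and>
    A = P ** embed_block S (signature_on S i) ** adjoint_matrix P"
  using assms
proof (induction S arbitrary: A rule: finite_linorder_max_induct)
  case empty
  then have "A = mat 1" by (simp add: supported_on_iff vec_eq_iff)
  moreover have "embed_block {} (signature_on {} 0) = (mat 1 :: ('a, 'n) square_matrix)"
    by (simp add: vec_eq_iff embed_block_nth mat_one_nth)
  ultimately show ?case
    by (intro exI[of _ 0] conjI bexI[of _ "mat 1"])
      (simp_all add: mat_one_unitary supported_on_iff)
next
  case (insert a T)
  let ?S = "insert a T"
  have aT: "a \<notin> T" using insert.hyps by auto
  show ?case
  proof (cases "\<forall>c\<in>?S. \<forall>b. mat 1 $ b $ c + A $ b $ c = 0")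
    case True
    have rank: "card {d\<in>?S. d < c} < card ?S" if "c \<in> ?S" for c
      using that insert.hyps(1) by (intro psubset_card_mono) auto
    have neg: "A $ b $ c = - (mat 1 $ b $ c)" if "c \<in> ?S" for b c
      using True that by (auto simp: eq_neg_iff_add_eq_0 add.commute)
    have "A $ b $ c = embed_block ?S (signature_on ?S (card ?S)) $ b $ c" for b c
    proof (cases "b \<in> ?S \<and> c \<in> ?S")
      case True
      then show ?thesis using neg[of c b] rank[of b]
        by (simp only: embed_block_nth signature_on_def mat_one_nth) simp
    next
      case False
      then have "A $ b $ c = mat 1 $ b $ c"
        using insert.prems(3) unfolding supported_on_iff by blast
      then show ?thesis using False by (simp only: embed_block_nth mat_one_nth if_False)
    qed
    then have "A = embed_block ?S (signature_on ?S (card ?S))" by (simp add: vec_eq_iff)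
    then show ?thesis
      by (intro exI[of _ "card ?S"] conjI bexI[of _ "mat 1"])
        (simp_all add: mat_one_unitary supported_on_iff)
  next
    case False
    then obtain b c where c: "c \<in> ?S" "mat 1 $ b $ c + A $ b $ c \<noteq> 0" by auto
    obtain v \<rho> where v: "(\<Sum>b\<in>UNIV. (norm (v b))\<^sup>2) = 1" "v a = \<rho> *\<^sub>R 1"
      "\<And>b. b \<notin> ?S \<Longrightarrow> v b = 0" "\<And>b. (\<Sum>d\<in>UNIV. A $ b $ d * v d) = v b"
      by (rule unit_eigenvector[OF insert.prems(2,3) c, of a]) blast
    obtain Q :: "('a, 'n) square_matrix" where Q: "Q \<in> unitary_group" "supported_on ?S Q" "\<And>b. Q $ b $ a = v b"
      by (rule householder[OF v(1,2) insertI1[of a T]]) (erule v(3), rule that)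
    define B where "B = adjoint_matrix Q ** A ** Q"
    have Bh: "adjoint_matrix B = B"
      by (simp add: B_def adjoint_mult insert.prems(1) matrix_mul_assoc)
    have "B ** B = adjoint_matrix Q ** (A ** (Q ** adjoint_matrix Q) ** A) ** Q"
      by (simp add: B_def matrix_mul_assoc)
    then have Binv: "B ** B = mat 1"
      using Q(1) by (simp add: unitary_left unitary_right insert.prems(2))
    have "(A ** Q) $ b $ a = Q $ b $ a" for b
      by (simp add: mult_nth Q(3) v(4))
    then have "B $ b $ a = (adjoint_matrix Q ** Q) $ b $ a" for b
      unfolding B_def matrix_mul_assoc[symmetric] by (simp add: mult_nth[of "adjoint_matrix Q"])
    then have col: "B $ b $ a = mat 1 $ b $ a" for b
      by (simp add: unitary_left Q(1))
    have row: "B $ a $ b = mat 1 $ a $ b" for b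
      using arg_cong[OF Bh, of "\<lambda>M. M $ a $ b"] col[of b]
      by (auto simp: adjoint_nth mat_one_nth star_one star_zero)
    have "supported_on ?S B"
      unfolding B_def using Q(2) insert.prems(3) by (intro supported_on_mult supported_on_adjoint)
    then have "supported_on T B"
      using col row unfolding supported_on_iff by (metis insert_iff)
    then obtain i P where i: "i \<le> card T" and P: "P \<in> unitary_group" "supported_on T P"
      "B = P ** embed_block T (signature_on T i) ** adjoint_matrix P"
      using insert.IH[OF Bh Binv] by blast
    have "embed_block T (signature_on T i) = (embed_block ?S (signature_on ?S i) :: ('a, 'n) square_matrix)"
    proof -
      have "{d\<in>?S. d < c} = {d\<in>T. d < c}" if "c \<in> T" for c
        using that insert.hyps(2) by auto
      moreover have "{d\<in>?S. d < a} = T" using insert.hyps(2) by auto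
      ultimately show ?thesis
        using i aT by (auto simp: vec_eq_iff embed_block_nth signature_on_def)
    qed
    moreover have "A = Q ** B ** adjoint_matrix Q"
    proof -
      have "Q ** B ** adjoint_matrix Q = (Q ** adjoint_matrix Q) ** A ** (Q ** adjoint_matrix Q)"
        by (simp add: B_def matrix_mul_assoc)
      then show ?thesis by (simp add: unitary_right Q(1))
    qed
    ultimately have "A = (Q ** P) ** embed_block ?S (signature_on ?S i) ** adjoint_matrix (Q ** P)"
      using P(3) by (simp add: adjoint_mult matrix_mul_assoc)
    moreover have "supported_on ?S (Q ** P)"
      using Q(2) P(2) by (intro supported_on_mult) (auto elim: supported_on_mono)
    moreover have "Q ** P \<in> unitary_group" using Q(1) P(1) by (rule unitary_mult)
    moreover have "i \<le> card ?S" using i aT insert.hyps(1) by simp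
    ultimately show ?thesis by blast
  qed
qed

section \<open>The critical components\<close>

lemma card_below_less:
  fixes a b :: "'n::{finite,linorder}"
  assumes "a < b"
  shows "card {c. c < a} < card {c. c < b}"
  using assms by (intro psubset_card_mono) auto

lemma card_below_less_card_UNIV: "card {c. c < a} < CARD('n)" for a :: "'n::{finite,linorder}"
  by (intro psubset_card_mono) auto

lemma
  fixes a :: "'n::{finite,linorder}"
  assumes "(\<Sum>q\<le>k. m q) = CARD('n)"
  shows block_index_le: "block_index m a \<le> k"
    and card_below_less_block: "card {c. c < a} < (\<Sum>p\<le>block_index m a. m p)"
proof -
  have *: "card {c. c < a} < (\<Sum>p\<le>k. m p)"
    using assms card_below_less_card_UNIV[of a] by simp
  show "block_index m a \<le> k" unfolding block_index_def using * by (rule Least_le)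
  show "card {c. c < a} < (\<Sum>p\<le>block_index m a. m p)"
    unfolding block_index_def using * by (rule LeastI)
qed

text \<open>
  Counting smaller elements is injective and maps the block into an interval of length \<open>m q\<close>.
\<close>

lemma card_diag_block_le:
  assumes "(\<Sum>q\<le>k. m q) = CARD('n::{finite,linorder})"
  shows "card (diag_block m q :: 'n set) \<le> m q"
proof -
  let ?r = "\<lambda>a :: 'n. card {c. c < a}"
  have "inj_on ?r (diag_block m q)"
    by (rule linorder_inj_onI) (auto dest: card_below_less)
  moreover have "?r ` diag_block m q \<subseteq> {sum m {..<q}..<sum m {..q}}"
  proof (clarsimp, intro conjI)
    fix a :: 'n assume "a \<in> diag_block m q"
    then have q: "q = block_index m a" by (simp add: diag_block_def)
    show "?r a < sum m {..q}" unfolding q using card_below_less_block[OF assms] .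
    show "sum m {..<q} \<le> ?r a"
    proof (cases q)
      case (Suc p)
      then have "p < block_index m a" using q by simp
      then have "\<not> ?r a < sum m {..p}" unfolding block_index_def by (rule not_less_Least)
      then show ?thesis using Suc by (simp add: lessThan_Suc_atMost)
    qed simp
  qed
  ultimately have "card (diag_block m q :: 'n set) \<le> card {sum m {..<q}..<sum m {..q}}"
    by (rule card_inj_on_le) simp
  also have "\<dots> = m q" by (simp add: lessThan_Suc_atMost[symmetric])
  finally show ?thesis .
qed

lemma repeated_diag_nth:
  "repeated_diag m t $ a $ b = (if a = b then t (block_index m a) *\<^sub>R 1 else 0)"
  by (simp add: repeated_diag_def scaleR_conv_of_real)

lemma repeated_diag_mult_nth:
  "(repeated_diag m t ** A) $ a $ b = t (block_index m a) *\<^sub>R A $ a $ b"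
proof -
  have "(repeated_diag m t ** A) $ a $ b
      = (\<Sum>c\<in>UNIV. if c = a then t (block_index m a) *\<^sub>R A $ c $ b else 0)"
    unfolding mult_nth by (intro sum.cong) (auto simp: repeated_diag_nth)
  then show ?thesis by simp
qed

lemma mult_repeated_diag_nth:
  "(A ** repeated_diag m t) $ a $ b = t (block_index m b) *\<^sub>R A $ a $ b"
proof -
  have "(A ** repeated_diag m t) $ a $ b
      = (\<Sum>c\<in>UNIV. if c = b then t (block_index m b) *\<^sub>R A $ a $ c else 0)"
    unfolding mult_nth by (intro sum.cong) (auto simp: repeated_diag_nth)
  then show ?thesis by simp
qed

lemma adjoint_repeated_diag: "adjoint_matrix (repeated_diag m t) = repeated_diag m t"
  by (simp add: vec_eq_iff adjoint_nth repeated_diag_nth star_scaleR star_one star_zero)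

lemma hermitian_involution_on_conjugate:
  fixes A :: "'n::{finite,linorder} \<Rightarrow> 'n \<Rightarrow> 'a::rch_algebra"
  assumes "mat_eq_on S (mat_star_on A) A" and "mat_eq_on S (mat_mult_on S A A) mat_one_on"
  shows "\<exists>i\<le>card S. conjugate_on S A (signature_on S i)"
proof -
  have "adjoint_matrix (embed_block S A) = embed_block S A"
    "embed_block S A ** embed_block S A = mat 1"
    using assms
    unfolding embed_block_eq_iff[symmetric] embed_block_star embed_block_mult embed_block_one
    by auto
  then obtain i P where i: "i \<le> card S" and P: "P \<in> unitary_group" "supported_on S P"
    "embed_block S A = P ** embed_block S (signature_on S i) ** adjoint_matrix P"
    using hermitian_involution_conjugate_signature[of S "embed_block S A"]
      supported_on_embed_block by auto
  then have "conjugate_on S A (signature_on S i)"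
    unfolding conjugate_on_iff supported_on_def by metis
  then show ?thesis using i by blast
qed

text \<open>
  The real part of the trace is invariant under conjugation because it is cyclic.
\<close>

lemma conjugate_on_trace:
  fixes A E :: "'n::finite \<Rightarrow> 'n \<Rightarrow> 'a::rch_algebra"
  assumes "conjugate_on S A E"
  shows "(\<Sum>a\<in>S. inner 1 (A a a)) = (\<Sum>a\<in>S. inner 1 (E a a))"
proof -
  have tr: "Re_trace (embed_block S M) = (\<Sum>a\<in>S. inner 1 (M a a)) + real (card (- S))"
    for M :: "'n \<Rightarrow> 'n \<Rightarrow> 'a"
  proof -
    have "Re_trace (embed_block S M) = (\<Sum>a\<in>UNIV. inner 1 (embed_block S M $ a $ a))"
      by (simp add: Re_trace_def trace_def inner_sum_right)
    also have "\<dots> = (\<Sum>a\<in>S. inner 1 (embed_block S M $ a $ a))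
        + (\<Sum>a\<in>- S. inner 1 (embed_block S M $ a $ a))"
      by (subst sum.union_disjoint[symmetric]) auto
    finally show ?thesis by (simp add: embed_block_nth dot_square_norm)
  qed
  obtain P where P: "embed_block S P \<in> unitary_group"
    "embed_block S A = embed_block S P ** embed_block S E ** adjoint_matrix (embed_block S P)"
    using assms unfolding conjugate_on_iff by auto
  have "Re_trace (embed_block S A) = Re_trace (embed_block S E)"
    unfolding P(2) by (subst Re_trace_mult_commute) (simp add: unitary_cancel(1)[OF P(1)]
      matrix_mul_assoc[symmetric])
  then show ?thesis by (simp add: tr)
qed

text \<open>
  The height of any point of the component. The argument of type \<open>itself\<close> carries the algebra and the
  index type, which do not occur among the other arguments.
\<close>

definition component_value :: "nat \<Rightarrow> (nat \<Rightarrow> nat) \<Rightarrow> (nat \<Rightarrow> real) \<Rightarrow> (nat \<Rightarrow> nat) \<Rightarrow>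
    ('a::rch_algebra, 'n::{finite,linorder}) square_matrix itself \<Rightarrow> real" where
  "component_value k m t i T = (\<Sum>q\<in>{1..k}. t q *
     (\<Sum>a\<in>diag_block m q. inner 1 (signature_on (diag_block m q :: 'n set) (i q) a a :: 'a)))"

lemma inner_repeated_diag_component:
  fixes A :: "('a::rch_algebra, 'n::{finite,linorder}) square_matrix"
  assumes m: "(\<Sum>q\<le>k. m q) = CARD('n)" and t0: "t 0 = 0" and A: "A \<in> diag_component k m i"
  shows "inner (repeated_diag m t) A
    = component_value k m t i TYPE(('a, 'n) square_matrix)"
proof -
  have "inner (repeated_diag m t) A = Re_trace (repeated_diag m t ** A)"
    by (simp add: inner_matrix_eq_Re_trace adjoint_repeated_diag)
  also have "\<dots> = (\<Sum>a\<in>UNIV. t (block_index m a) * inner 1 (A $ a $ a))"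
    by (simp add: Re_trace_def trace_def inner_sum_right repeated_diag_mult_nth)
  also have "\<dots> = (\<Sum>q\<le>k. \<Sum>a | a \<in> UNIV \<and> block_index m a = q.
      t (block_index m a) * inner 1 (A $ a $ a))"
    using block_index_le[OF m] by (intro sum.group[symmetric]) auto
  also have "\<dots> = (\<Sum>q\<le>k. t q * (\<Sum>a\<in>diag_block m q. inner 1 (A $ a $ a)))"
    by (simp add: diag_block_def sum_distrib_left)
  also have "\<dots> = (\<Sum>q\<in>{1..k}. t q * (\<Sum>a\<in>diag_block m q. inner 1 (A $ a $ a)))"
    using t0 by (intro sum.mono_neutral_right) (auto simp: not_less_eq_eq)
  also have "\<dots> = component_value k m t i TYPE(('a, 'n) square_matrix)"
    unfolding component_value_def
  proof (intro sum.cong refl)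
    fix q assume "q \<in> {1..k}"
    then have "conjugate_on (diag_block m q) (\<lambda>a b. A $ a $ b) (signature_on (diag_block m q) (i q))"
      using A unfolding diag_component_def by blast
    from conjugate_on_trace[OF this]
    show "t q * (\<Sum>a\<in>diag_block m q. inner 1 (A $ a $ a)) = t q *
      (\<Sum>a\<in>diag_block m q. inner 1 (signature_on (diag_block m q :: 'n set) (i q) a a :: 'a))"
      by simp
  qed
  finally show ?thesis .
qed

text \<open>
  Write \<open>D\<close> for the diagonal matrix. The equation says that \<open>A D\<close> is hermitian, and computing its
  square in two ways shows that \<open>A\<close> commutes with \<open>D\<^sup>2\<close>. The numbers \<open>t q\<close> are distinct and nonnegative,
  so their squares are distinct and \<open>A\<close> is block diagonal. On a block with \<open>t q > 0\<close> the equation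
  reduces to \<open>A\<close> being hermitian, hence a unitary involution, which is conjugate to a signature.
\<close>

lemma diag_component_if_hermitian_product:
  fixes A :: "('a::rch_algebra, 'n::{finite,linorder}) square_matrix"
  assumes m: "(\<Sum>q\<le>k. m q) = CARD('n)" and t0: "t 0 = 0" and t: "strict_mono_on {0..k} t"
    and A: "A \<in> unitary_group"
    and eq: "repeated_diag m t ** adjoint_matrix A = A ** repeated_diag m t"
  shows "\<exists>i\<in>(\<Pi>\<^sub>E q\<in>{1..k}. {0..m q}). A \<in> diag_component k m i"
proof -
  let ?D = "repeated_diag m t :: ('a, 'n) square_matrix"
  have ge0: "t (block_index m a) \<ge> 0" for a :: 'n
    using strict_mono_onD[OF t, of 0 "block_index m a"] block_index_le[OF m, of a] t0
    by (cases "block_index m a = 0") auto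
  have pos: "t q > 0" if "q \<in> {1..k}" for q
    using strict_mono_onD[OF t, of 0 q] that t0 by auto
  have "A ** (?D ** ?D) ** adjoint_matrix A = (A ** ?D) ** adjoint_matrix (A ** ?D)"
    by (simp add: adjoint_mult adjoint_repeated_diag matrix_mul_assoc)
  also have "\<dots> = ?D ** (adjoint_matrix A ** A) ** ?D"
    unfolding eq[symmetric] by (simp add: adjoint_mult adjoint_repeated_diag matrix_mul_assoc)
  also have "\<dots> = ?D ** ?D" by (simp add: unitary_left[OF A])
  finally have "A ** (?D ** ?D) ** adjoint_matrix A ** A = ?D ** ?D ** A" by simp
  then have comm: "A ** ?D ** ?D = ?D ** (?D ** A)"
    by (simp add: unitary_cancel[OF A] matrix_mul_assoc)
  have block: "A $ a $ b = 0" if "block_index m a \<noteq> block_index m b" for a b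
  proof -
    have "t (block_index m a) \<noteq> t (block_index m b)"
      using that block_index_le[OF m] strict_mono_on_imp_inj_on[OF t]
      by (auto simp: inj_on_def)
    moreover have "(t (block_index m b) * t (block_index m b)) *\<^sub>R A $ a $ b
        = (t (block_index m a) * t (block_index m a)) *\<^sub>R A $ a $ b"
      using arg_cong[OF comm, of "\<lambda>M. M $ a $ b"]
      by (simp add: repeated_diag_mult_nth mult_repeated_diag_nth)
    ultimately show ?thesis
      using ge0[of a] ge0[of b] by (auto simp: square_eq_iff)
  qed
  have unitary: "mat_mult_on (diag_block m q) (\<lambda>a b. A $ a $ b) (mat_star_on (\<lambda>a b. A $ a $ b)) a b
      = mat_one_on a b" if "a \<in> diag_block m q" for q a b
  proof -
    have "mat_mult_on (diag_block m q) (\<lambda>a b. A $ a $ b) (mat_star_on (\<lambda>a b. A $ a $ b)) a b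
        = (\<Sum>c\<in>UNIV. A $ a $ c * star (A $ b $ c))"
      unfolding mat_mult_on_def mat_star_on_def
      using that by (intro sum.mono_neutral_left) (auto simp: diag_block_def block)
    also have "\<dots> = (A ** adjoint_matrix A) $ a $ b" by (simp add: mult_nth adjoint_nth)
    finally show ?thesis by (simp add: unitary_right[OF A] mat_one_on_def mat_one_nth)
  qed
  \<comment> \<open>The positive factor \<open>t q\<close> cancels from both sides of the hypothesis.\<close>
  have herm: "star (A $ b $ a) = A $ a $ b"
    if "a \<in> diag_block m q" "b \<in> diag_block m q" "q \<in> {1..k}" for a b q
    using arg_cong[OF eq, of "\<lambda>M. M $ a $ b"] that pos[OF that(3)]
    by (simp add: repeated_diag_mult_nth mult_repeated_diag_nth adjoint_nth diag_block_def)
  have invol: "mat_eq_on (diag_block m q)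
      (mat_mult_on (diag_block m q) (\<lambda>a b. A $ a $ b) (\<lambda>a b. A $ a $ b)) mat_one_on"
    if "q \<in> {1..k}" for q
    unfolding mat_eq_on_def
  proof (intro ballI)
    fix a b :: 'n assume ab: "a \<in> diag_block m q" "b \<in> diag_block m q"
    have "mat_mult_on (diag_block m q) (\<lambda>a b. A $ a $ b) (\<lambda>a b. A $ a $ b) a b
        = mat_mult_on (diag_block m q) (\<lambda>a b. A $ a $ b) (mat_star_on (\<lambda>a b. A $ a $ b)) a b"
      unfolding mat_mult_on_def mat_star_on_def
      using herm[OF _ ab(2) that] by (intro sum.cong) auto
    then show "mat_mult_on (diag_block m q) (\<lambda>a b. A $ a $ b) (\<lambda>a b. A $ a $ b) a b = mat_one_on a b"
      using unitary[OF ab(1)] by simp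
  qed
  have "\<exists>j\<in>{0..m q}. conjugate_on (diag_block m q) (\<lambda>a b. A $ a $ b) (signature_on (diag_block m q) j)"
    if q: "q \<in> {1..k}" for q
  proof -
    have "mat_eq_on (diag_block m q) (mat_star_on (\<lambda>a b. A $ a $ b)) (\<lambda>a b. A $ a $ b)"
      unfolding mat_eq_on_def mat_star_on_def using herm q by blast
    from hermitian_involution_on_conjugate[OF this invol[OF q]]
    obtain j where "j \<le> card (diag_block m q :: 'n set)"
      "conjugate_on (diag_block m q) (\<lambda>a b. A $ a $ b) (signature_on (diag_block m q) j)" by blast
    then show ?thesis using card_diag_block_le[OF m, of q] by (intro bexI[of _ j]) auto
  qed
  then obtain i where i: "\<And>q. q \<in> {1..k} \<Longrightarrow> i q \<in> {0..m q} \<and>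
      conjugate_on (diag_block m q) (\<lambda>a b. A $ a $ b) (signature_on (diag_block m q) (i q))"
    by metis
  have "A \<in> diag_component k m (restrict i {1..k})"
    unfolding diag_component_def
    using block invol i unitary by (auto simp: unitary_on_def mat_eq_on_def)
  moreover have "restrict i {1..k} \<in> (\<Pi>\<^sub>E q\<in>{1..k}. {0..m q})"
    using i by auto
  ultimately show ?thesis by blast
qed

section \<open>The category inequality\<close>

theorem theorem3p4:
  fixes X U V :: "('a::rch_algebra, 'n::{finite,linorder}) square_matrix"
    and k :: nat and m :: "nat \<Rightarrow> nat" and t :: "nat \<Rightarrow> real"
  assumes "norm X = 1"
    and "t 0 = 0" and "strict_mono_on {0..k} t"
    and "\<And>q. q \<in> {1..k} \<Longrightarrow> m q \<ge> 1"
    and "(\<Sum>q\<le>k. m q) = CARD('n)"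
    and "U \<in> unitary_group" and "V \<in> unitary_group"
    and "X = U ** repeated_diag m t ** adjoint_matrix V"
  shows "LS_category (unitary_group :: ('a, 'n) square_matrix set) + 1 \<le>
    (\<Sum>i \<in> (\<Pi>\<^sub>E q\<in>{1..k}. {0..m q}).
       (rel_category unitary_group (critical_component X U V k m i) + 1))"
proof -
  let ?G = "unitary_group :: ('a, 'n) square_matrix set"
  let ?I = "\<Pi>\<^sub>E q\<in>{1..k}. {0..m q}"
  let ?D = "repeated_diag m t :: ('a, 'n) square_matrix"
  let ?\<Sigma> = "critical_component X U V k m"
  let ?cat = "\<lambda>i. rel_category ?G (?\<Sigma> i)"
  have finI: "finite ?I" by (intro finite_PiE) auto
  have height_const: "height X A = component_value k m t i TYPE(('a, 'n) square_matrix)"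
    if "A \<in> ?\<Sigma> i" for A i
  proof -
    have "height X A = inner (U ** (?D ** adjoint_matrix V)) A"
      by (simp add: height_eq_inner assms(8) matrix_mul_assoc)
    also have "\<dots> = inner (?D ** adjoint_matrix V) (adjoint_matrix U ** A)"
      using inner_mult_left_adjoint[of A U "?D ** adjoint_matrix V"] by (simp add: inner_commute)
    also have "\<dots> = inner ?D (adjoint_matrix U ** A ** V)"
      using inner_mult_right_adjoint[of "adjoint_matrix U ** A" ?D "adjoint_matrix V"]
      by (simp add: inner_commute)
    finally show ?thesis
      using that inner_repeated_diag_component[of m k t "adjoint_matrix U ** A ** V" i, OF assms(5,2)]
      unfolding critical_component_def by simp
  qed
  \<comment> \<open>The change of variables \<open>A \<mapsto> U\<^sup>* A V\<close> turns the vanishing of the generator for \<open>X\<close> into the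
    hermitian condition for the diagonal matrix.\<close>
  have stationary: "\<exists>i\<in>?I. A \<in> ?\<Sigma> i" if A: "A \<in> ?G" and W: "gradient_generator X A = 0" for A
  proof -
    let ?B = "adjoint_matrix U ** A ** V"
    have B: "?B \<in> ?G" using A assms(6,7) by (intro unitary_mult unitary_adjoint)
    have "U ** ?D ** adjoint_matrix V ** adjoint_matrix A = A ** V ** ?D ** adjoint_matrix U"
      using W by (simp add: gradient_generator_def assms(8) adjoint_mult adjoint_repeated_diag
          matrix_mul_assoc)
    then have "adjoint_matrix U ** (U ** ?D ** adjoint_matrix V ** adjoint_matrix A) ** U
        = adjoint_matrix U ** (A ** V ** ?D ** adjoint_matrix U) ** U" by simp
    then have "?D ** adjoint_matrix ?B = ?B ** ?D"
      using assms(6) by (simp add: adjoint_mult matrix_mul_assoc unitary_cancel unitary_left)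
    from diag_component_if_hermitian_product[OF assms(5,2,3) B this]
    show ?thesis
      using critical_if_generator_zero[OF A W] by (auto simp: critical_component_def)
  qed
  show ?thesis
  proof (cases "\<exists>i\<in>?I. ?cat i = \<infinity>")
    case True
    then obtain i where i: "i \<in> ?I" "?cat i = \<infinity>" by blast
    have "?cat i + 1 \<le> (\<Sum>i\<in>?I. ?cat i + 1)"
      using i(1) finI by (intro member_le_sum) auto
    then show ?thesis using i(2) by simp
  next
    case False
    then have "\<forall>i\<in>?I. \<exists>n. ?cat i = enat n" by auto
    then obtain n where n: "\<And>i. i \<in> ?I \<Longrightarrow> ?cat i = enat (n i)" by metis
    obtain \<phi> where \<phi>: "homotopic_with_canon (\<lambda>_. True) ?G ?G (\<lambda>A. A) \<phi>"
      "\<And>A. A \<in> ?G \<Longrightarrow> height X A \<le> height X (\<phi> A)"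
      "\<And>A. A \<in> ?G \<Longrightarrow> height X (\<phi> A) = height X A \<Longrightarrow> gradient_generator X A = 0"
      using ascent_step_exists by blast
    have "categorical_cover ?G (\<Sum>i\<in>?I. Suc (n i)) ?G"
    proof (rule categorical_cover_of_ascent[where f = "height X" and \<phi> = \<phi> and K = ?\<Sigma>
          and c = "\<lambda>i. component_value k m t i TYPE(('a, 'n) square_matrix)"])
      show "continuous_on ?G (height X)"
        unfolding height_eq_inner[abs_def] by (intro continuous_intros)
      show "\<exists>i\<in>?I. A \<in> ?\<Sigma> i" if "A \<in> ?G" "height X (\<phi> A) = height X A" for A
        using stationary \<phi>(3) that by blast
      show "categorical_cover ?G (Suc (n i)) (?\<Sigma> i)" if "i \<in> ?I" for i
        using n[OF that] by (rule categorical_cover_rel_category)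
    qed (use compact_unitary_group \<phi> finI height_const in auto)
    moreover have "?G \<noteq> {}" using mat_one_unitary by blast
    ultimately have "LS_category ?G + 1 \<le> enat (\<Sum>i\<in>?I. Suc (n i))"
      by (rule LS_category_le)
    also have "\<dots> = (\<Sum>i\<in>?I. enat (Suc (n i)))"
      using of_nat_sum[of "\<lambda>i. Suc (n i)" ?I, where 'a = enat] by (simp add: of_nat_eq_enat)
    also have "\<dots> = (\<Sum>i\<in>?I. ?cat i + 1)"
      using n by (intro sum.cong) (auto simp: one_enat_def)
    finally show ?thesis .
  qed
qed

end
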